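(* Let $E\in\mathcal{I}\cup\mathcal{I}_{\mathcal{R}}$, i.e. $E\subset\mathbb{H}^n$ is a compact isodiametric set, or a compact rotationally invariant set that is isodiametric within the class of rotationally invariant sets. Then for all $p\in\partial E$ there exists $q\in\partial E$ such that $d(p,q)=\operatorname{diam}E$.
   Context: Let $n\ge 1$. The Heisenberg group is $\mathbb{H}^n=\mathbb{C}^n\times\mathbb{R}\approx\mathbb{R}^{2n+1}$ with points $[z,t]$, $z=(z_1,\dots,z_n)$, $z_j=x_j+iy_j$, and group law $[z,t]\cdot[z',t']=[z+z',\,t+t'+2\operatorname{Im} z\overline{z}']$, where $\operatorname{Im} z\overline z'=\sum_j\operatorname{Im} z_j\overline{z}'_j$. Put $X_j=\partial_{x_j}+2y_j\partial_t$, $Y_j=\partial_{y_j}-2x_j\partial_t$. A curve is horizontal if it is absolutely continuous and its tangent vector lies a.e. in $\operatorname{span}\{X_j,Y_j\}_{j}$. Fix the left-invariant Riemannian metric making $(X_1,\dots,X_n,Y_1,\dots,Y_n,\partial_t)$ orthonormal; the Carnot-Carathéodory distance $d(p,q)$ is the infimum of the Riemannian lengths of horizontal curves joining $p$ to $q$. It induces the usual topology. Diameters are with respect to $d$; $\mathcal{L}^{2n+1}$ is Lebesgue (outer) measure on $\mathbb{R}^{2n+1}$. Isodiametric classes: $C_I=\sup\{\mathcal{L}^{2n+1}(F)/(\operatorname{diam}F)^{2n+2} : F\subset\mathbb{H}^n,\ 0<\operatorname{diam}F<+\infty\}$ and $\mathcal{I}=\{E\subset\mathbb{H}^n : E \text{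 compact},\ \operatorname{diam}E>0,\ \mathcal{L}^{2n+1}(E)=C_I(\operatorname{diam}E)^{2n+2}\}$. For $\theta\in\mathbb{R}^n$ let $r_\theta([z,t])=[(e^{i\theta_1}z_1,\dots,e^{i\theta_n}z_n),t]$, and let $\mathcal{R}=\{F\subset\mathbb{H}^n : r_\theta(F)\subset F\text{ for all }\theta\in\mathbb{R}^n\}$ (rotationally invariant sets). $C_{I,\mathcal{R}}$ is the supremum of $\mathcal{L}^{2n+1}(F)/(\operatorname{diam}F)^{2n+2}$ over $F\in\mathcal{R}$ with $0<\operatorname{diam}F<+\infty$, and $\mathcal{I}_{\mathcal{R}}=\{E\in\mathcal{R} : E\text{ compact},\ \operatorname{diam}E>0,\ \mathcal{L}^{2n+1}(E)=C_{I,\mathcal{R}}(\operatorname{diam}E)^{2n+2}\}$. *)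

theory Defs
  imports "HOL-Analysis.Analysis"
begin

text \<open>
  Points of the Heisenberg group are pairs \<open>(z, t)\<close>.  As a product Euclidean space the type carries
  the Lebesgue measure and the topology of real dimension \<open>2 * CARD('n) + 1\<close>.
\<close>
type_synonym 'n heis = "(complex ^ 'n) \<times> real"

definition heis_mult :: "'n::finite heis \<Rightarrow> 'n heis \<Rightarrow> 'n heis" where
  "heis_mult p q = (fst p + fst q, snd p + snd q + 2 * (\<Sum>j\<in>UNIV. Im (fst p $ j * cnj (fst q $ j))))"

text \<open>The left-invariant frame; tangent vectors are identified with elements of the vector space.\<close>

definition X_field :: "'n::finite \<Rightarrow> 'n heis \<Rightarrow> 'n heis" where
  "X_field j p = (axis j 1, 2 * Im (fst p $ j))"

definition Y_field :: "'n::finite \<Rightarrow> 'n heis \<Rightarrow> 'n heis" where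
  "Y_field j p = (axis j \<i>, - 2 * Re (fst p $ j))"

definition T_field :: "'n::finite heis \<Rightarrow> 'n heis" where
  "T_field p = (0, 1)"

definition horizontal_space :: "'n::finite heis \<Rightarrow> 'n heis set" where
  "horizontal_space p = span (range (\<lambda>j. X_field j p) \<union> range (\<lambda>j. Y_field j p))"

text \<open>
  Coefficient of \<open>T_field p\<close> when \<open>v\<close> is expanded in the frame at \<open>p\<close>; the coefficients of
  \<open>X_field j p\<close> and \<open>Y_field j p\<close> are \<open>Re (fst v $ j)\<close> and \<open>Im (fst v $ j)\<close>.
\<close>
definition T_coeff :: "'n::finite heis \<Rightarrow> 'n heis \<Rightarrow> real" where
  "T_coeff p v =
     snd v - 2 * (\<Sum>j\<in>UNIV. Im (fst p $ j) * Re (fst v $ j) - Re (fst p $ j) * Im (fst v $ j))"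

text \<open>
  The Riemannian metric making the frame orthonormal: the sum of the products of the frame
  coefficients.
\<close>
definition riem_inner :: "'n::finite heis \<Rightarrow> 'n heis \<Rightarrow> 'n heis \<Rightarrow> real" where
  "riem_inner p v w =
     (\<Sum>j\<in>UNIV. Re (fst v $ j) * Re (fst w $ j) + Im (fst v $ j) * Im (fst w $ j))
       + T_coeff p v * T_coeff p w"

definition riem_norm :: "'n::finite heis \<Rightarrow> 'n heis \<Rightarrow> real" where
  "riem_norm p v = sqrt (riem_inner p v v)"

lemma frame_expansion:
  "v = (\<Sum>j\<in>UNIV. Re (fst v $ j) *\<^sub>R X_field j p + Im (fst v $ j) *\<^sub>R Y_field j p)
         + T_coeff p v *\<^sub>R T_field p"
proof (rule prod_eqI)
  have "(\<Sum>j\<in>UNIV. Re (z $ j) *\<^sub>R axis j 1 + Im (z $ j) *\<^sub>R axis j \<i>) = z" for z :: "complex ^ 'a"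
  proof (rule vec_eq_iff[THEN iffD2], rule allI)
    fix i
    have "(\<Sum>j\<in>UNIV. Re (z $ j) *\<^sub>R axis j 1 + Im (z $ j) *\<^sub>R axis j \<i>) $ i
            = (\<Sum>j\<in>UNIV. if i = j then z $ i else 0)"
      unfolding sum_component
      by (rule sum.cong) (auto simp: axis_def complex_eq_iff)
    then show "(\<Sum>j\<in>UNIV. Re (z $ j) *\<^sub>R axis j 1 + Im (z $ j) *\<^sub>R axis j \<i>) $ i = z $ i"
      by simp
  qed
  then show "fst v = fst ((\<Sum>j\<in>UNIV. Re (fst v $ j) *\<^sub>R X_field j p + Im (fst v $ j) *\<^sub>R Y_field j p)
         + T_coeff p v *\<^sub>R T_field p)"
    by (simp add: X_field_def Y_field_def T_field_def fst_sum)
  show "snd v = snd ((\<Sum>j\<in>UNIV. Re (fst v $ j) *\<^sub>R X_field j p + Im (fst v $ j) *\<^sub>R Y_field j p)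
         + T_coeff p v *\<^sub>R T_field p)"
    by (simp add: X_field_def Y_field_def T_field_def T_coeff_def snd_sum sum_distrib_left
        algebra_simps)
qed

lemma frame_orthonormal:
  "riem_inner p (X_field i p) (X_field j p) = (if i = j then 1 else 0)"
  "riem_inner p (Y_field i p) (Y_field j p) = (if i = j then 1 else 0)"
  "riem_inner p (X_field i p) (Y_field j p) = 0"
  "riem_inner p (X_field i p) (T_field p) = 0"
  "riem_inner p (Y_field i p) (T_field p) = 0"
  "riem_inner p (T_field p) (T_field p) = 1"
proof -
  have TX: "T_coeff p (X_field k p) = 0" for k
  proof -
    have "(\<Sum>l\<in>UNIV. Im (fst p $ l) * Re (axis k 1 $ l) - Re (fst p $ l) * Im (axis k (1::complex) $ l))
            = (\<Sum>l\<in>UNIV. if l = k then Im (fst p $ l) else 0)"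
      by (rule sum.cong) (auto simp: axis_def)
    then show ?thesis by (simp add: T_coeff_def X_field_def)
  qed
  have TY: "T_coeff p (Y_field k p) = 0" for k
  proof -
    have "(\<Sum>l\<in>UNIV. Im (fst p $ l) * Re (axis k \<i> $ l) - Re (fst p $ l) * Im (axis k \<i> $ l))
            = (\<Sum>l\<in>UNIV. if l = k then - Re (fst p $ l) else 0)"
      by (rule sum.cong) (auto simp: axis_def)
    then show ?thesis by (simp add: T_coeff_def Y_field_def)
  qed
  have ax: "(\<Sum>l\<in>UNIV. Re (axis i c $ l) * Re (axis j d $ l) + Im (axis i c $ l) * Im (axis j d $ l))
              = (if i = j then Re c * Re d + Im c * Im d else 0)" for i j :: 'a and c d :: complex
  proof -
    have "(\<Sum>l\<in>UNIV. Re (axis i c $ l) * Re (axis j d $ l) + Im (axis i c $ l) * Im (axis j d $ l))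
            = (\<Sum>l\<in>UNIV. if l = i then (if i = j then Re c * Re d + Im c * Im d else 0) else 0)"
      by (rule sum.cong) (auto simp: axis_def)
    then show ?thesis by simp
  qed
  show "riem_inner p (X_field i p) (X_field j p) = (if i = j then 1 else 0)"
    "riem_inner p (Y_field i p) (Y_field j p) = (if i = j then 1 else 0)"
    "riem_inner p (X_field i p) (Y_field j p) = 0"
    unfolding riem_inner_def TX TY by (auto simp: X_field_def Y_field_def ax)
  show "riem_inner p (X_field i p) (T_field p) = 0"
    "riem_inner p (Y_field i p) (T_field p) = 0"
    unfolding riem_inner_def TX TY by (auto simp: T_field_def)
  show "riem_inner p (T_field p) (T_field p) = 1"
    by (simp add: riem_inner_def T_coeff_def T_field_def)
qed

text \<open>
  Left invariance.  The left translation \<open>heis_mult p\<close> is affine, so its differential at any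
  point maps \<open>v\<close> to \<open>heis_mult p v - p\<close>.
\<close>
lemma riem_inner_left_invariant:
  "riem_inner (heis_mult p q) (heis_mult p v - p) (heis_mult p w - p) = riem_inner q v w"
proof -
  have "T_coeff (heis_mult p q) (heis_mult p u - p) = T_coeff q u" for u
    by (simp add: T_coeff_def heis_mult_def algebra_simps sum.distrib sum_subtractf
        sum_distrib_left)
  then show ?thesis
    by (simp add: riem_inner_def heis_mult_def)
qed

text \<open>
  Members of \<open>D\<close> are nonoverlapping compact intervals, so that \<open>Inf K\<close> and \<open>Sup K\<close> are the
  endpoints of \<open>K\<close>.
\<close>
definition abs_continuous_on_interval :: "real \<Rightarrow> real \<Rightarrow> (real \<Rightarrow> 'a::metric_space) \<Rightarrow> bool" where
  "abs_continuous_on_interval a b \<gamma> \<longleftrightarrow>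
     (\<forall>\<epsilon>>0. \<exists>\<delta>>0. \<forall>D. D division_of \<Union>D \<and> \<Union>D \<subseteq> {a..b} \<and> (\<Sum>K\<in>D. Sup K - Inf K) < \<delta>
        \<longrightarrow> (\<Sum>K\<in>D. dist (\<gamma> (Inf K)) (\<gamma> (Sup K))) < \<epsilon>)"

definition horizontal_curve :: "real \<Rightarrow> real \<Rightarrow> (real \<Rightarrow> 'n::finite heis) \<Rightarrow> bool" where
  "horizontal_curve a b \<gamma> \<longleftrightarrow>
     abs_continuous_on_interval a b \<gamma> \<and>
     (AE s in lebesgue_on {a..b}.
        \<gamma> differentiable (at s within {a..b}) \<and>
        vector_derivative \<gamma> (at s within {a..b}) \<in> horizontal_space (\<gamma> s))"

definition riem_length :: "real \<Rightarrow> real \<Rightarrow> (real \<Rightarrow> 'n::finite heis) \<Rightarrow> ennreal" where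
  "riem_length a b \<gamma> =
     (\<integral>\<^sup>+ s. ennreal (riem_norm (\<gamma> s) (vector_derivative \<gamma> (at s within {a..b})))
        \<partial>lebesgue_on {a..b})"

definition cc_dist :: "'n::finite heis \<Rightarrow> 'n heis \<Rightarrow> ennreal" where
  "cc_dist p q =
     Inf {riem_length a b \<gamma> | a b \<gamma>. a < b \<and> horizontal_curve a b \<gamma> \<and> \<gamma> a = p \<and> \<gamma> b = q}"

definition cc_diam :: "'n::finite heis set \<Rightarrow> ennreal" where
  "cc_diam F = (SUP p\<in>F. SUP q\<in>F. cc_dist p q)"

definition rot :: "real ^ 'n \<Rightarrow> 'n::finite heis \<Rightarrow> 'n heis" where
  "rot \<theta> p = ((\<chi> j. cis (\<theta> $ j) * fst p $ j), snd p)"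

definition rot_invariant_sets :: "'n::finite heis set set" where
  "rot_invariant_sets = {F. \<forall>\<theta>. rot \<theta> ` F \<subseteq> F}"

text \<open>
  The isodiametric constant and the compact isodiametric sets relative to a class \<open>\<C>\<close> of
  competitors; \<open>\<C> = UNIV\<close> gives the unrestricted problem.
\<close>

definition isodiam_const :: "'n::finite heis set set \<Rightarrow> ennreal" where
  "isodiam_const \<C> =
     (SUP F \<in> {F \<in> \<C>. 0 < cc_diam F \<and> cc_diam F < \<infinity>}.
        outer_measure_of lebesgue F / cc_diam F ^ (2 * CARD('n) + 2))"

definition isodiam_sets_in :: "'n::finite heis set set \<Rightarrow> 'n heis set set" where
  "isodiam_sets_in \<C> =
     {E \<in> \<C>. compact E \<and> 0 < cc_diam E \<and>
        outer_measure_of lebesgue E = isodiam_const \<C> * cc_diam E ^ (2 * CARD('n) + 2)}"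

abbreviation isodiam_sets :: "'n::finite heis set set" where
  "isodiam_sets \<equiv> isodiam_sets_in UNIV"

abbreviation rot_isodiam_sets :: "'n::finite heis set set" where
  "rot_isodiam_sets \<equiv> isodiam_sets_in rot_invariant_sets"

end

(*
  If every point of E were at distance less than diam E from the boundary point p, then a small ball
  around p (together with all its rotated copies in the rotationally invariant case) could be added to E
  without increasing the diameter; this strictly increases the measure, as p lies in the closure of the
  open complement of E, contradicting extremality.  By compactness some q in E is thus at distance
  diam E from p, and q is not interior because a dilation centred at p moves it outwards.

  The argument needs that d is a finite left-invariant pseudometric, invariant under rotations,
  homogeneous under dilations, and continuous for the Euclidean topology.  Continuity comes from
  d(0, [z, t]) <= |z| + 2 sqrt |t|, with [0, t] written as a commutator of horizontal segments.
*)
theory Submission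
  imports Defs
begin

section \<open>Absolute continuity and integrals of arbitrary functions\<close>

text \<open>Lengths are lower integrals of speeds that may fail to be measurable, so the length of a
  rescaled or joined curve is only bounded from above, through measurable minorants. Equalities
  between distances come afterwards, from applying such a bound to a symmetry and to its inverse.
  All symmetries in question are affine maps whose linear part preserves horizontality and scales
  the C^n component by a constant factor; \<open>cc_dist_affine_le\<close> treats them together.

  In the rotationally invariant case the delicate pairs are points in two different copies of the
  ball. Rotating both back leaves one relative angle, and the centre of the second copy is then a
  rotated image of \<open>p\<close>. It lies in \<open>E\<close>, so it too is at distance less than
  diam E from \<open>p\<close>.\<close>

text \<open>
  Absolute continuity in terms of indexed families of intervals instead of divisions: a family, unlike
  a set of intervals, may be collapsed by a weakly monotone map.  The index type only has to contain the
  intervals of a division.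
\<close>
definition ac_modulus :: "real \<Rightarrow> real \<Rightarrow> (real \<Rightarrow> 'a::metric_space) \<Rightarrow> real \<Rightarrow> real \<Rightarrow> bool" where
  "ac_modulus a b \<gamma> \<epsilon> \<delta> \<longleftrightarrow>
    (\<forall>(I::real set set) u v. finite I \<longrightarrow>
       (\<forall>i\<in>I. a \<le> u i \<and> u i \<le> v i \<and> v i \<le> b) \<longrightarrow>
       (\<forall>i\<in>I. \<forall>j\<in>I. i \<noteq> j \<longrightarrow> v i \<le> u j \<or> v j \<le> u i) \<longrightarrow>
       (\<Sum>i\<in>I. v i - u i) < \<delta> \<longrightarrow> (\<Sum>i\<in>I. dist (\<gamma> (u i)) (\<gamma> (v i))) < \<epsilon>)"

lemma ac_modulusI:
  assumes "\<And>(I::real set set) u v. \<lbrakk>finite I; \<And>i. i \<in> I \<Longrightarrow> a \<le> u i \<and> u i \<le> v i \<and> v i \<le> b;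
      \<And>i j. \<lbrakk>i \<in> I; j \<in> I; i \<noteq> j\<rbrakk> \<Longrightarrow> v i \<le> u j \<or> v j \<le> u i; (\<Sum>i\<in>I. v i - u i) < \<delta>\<rbrakk>
      \<Longrightarrow> (\<Sum>i\<in>I. dist (\<gamma> (u i)) (\<gamma> (v i))) < \<epsilon>"
  shows "ac_modulus a b \<gamma> \<epsilon> \<delta>"
  unfolding ac_modulus_def by (intro allI impI, rule assms) simp_all

lemma ac_modulusD:
  fixes I :: "real set set"
  assumes "ac_modulus a b \<gamma> \<epsilon> \<delta>" "finite I"
    "\<And>i. i \<in> I \<Longrightarrow> a \<le> u i \<and> u i \<le> v i \<and> v i \<le> b"
    "\<And>i j. \<lbrakk>i \<in> I; j \<in> I; i \<noteq> j\<rbrakk> \<Longrightarrow> v i \<le> u j \<or> v j \<le> u i" "(\<Sum>i\<in>I. v i - u i) < \<delta>"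
  shows "(\<Sum>i\<in>I. dist (\<gamma> (u i)) (\<gamma> (v i))) < \<epsilon>"
  using assms(1)[unfolded ac_modulus_def, rule_format, of I u v] assms(2-) by simp

text \<open>A family without its one-point intervals is an injectively indexed division; conversely
  a division serves as its own index set, with \<open>Inf\<close> and \<open>Sup\<close> as
  endpoints. One-point intervals contribute zero to both sums.\<close>

lemma ac_iff_modulus:
  fixes \<gamma> :: "real \<Rightarrow> 'a::metric_space"
  shows "abs_continuous_on_interval a b \<gamma> \<longleftrightarrow> (\<forall>\<epsilon>>0. \<exists>\<delta>>0. ac_modulus a b \<gamma> \<epsilon> \<delta>)"
proof
  assume L: "abs_continuous_on_interval a b \<gamma>"
  show "\<forall>\<epsilon>>0. \<exists>\<delta>>0. ac_modulus a b \<gamma> \<epsilon> \<delta>"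
  proof (intro allI impI)
    fix \<epsilon> :: real assume "\<epsilon> > 0"
    then obtain \<delta> where "\<delta> > 0" and \<delta>: "\<And>D. D division_of \<Union>D \<Longrightarrow> \<Union>D \<subseteq> {a..b} \<Longrightarrow>
        (\<Sum>K\<in>D. Sup K - Inf K) < \<delta> \<Longrightarrow> (\<Sum>K\<in>D. dist (\<gamma> (Inf K)) (\<gamma> (Sup K))) < \<epsilon>"
      using L[unfolded abs_continuous_on_interval_def, rule_format, of \<epsilon>] by auto
    have "ac_modulus a b \<gamma> \<epsilon> \<delta>"
    proof (rule ac_modulusI)
      fix I :: "real set set" and u v
      assume fin: "finite I" and uv: "\<And>i. i \<in> I \<Longrightarrow> a \<le> u i \<and> u i \<le> v i \<and> v i \<le> b"
        and dj: "\<And>i j. \<lbrakk>i \<in> I; j \<in> I; i \<noteq> j\<rbrakk> \<Longrightarrow> v i \<le> u j \<or> v j \<le> u i"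
        and less: "(\<Sum>i\<in>I. v i - u i) < \<delta>"
      \<comment> \<open>Several indices may carry the same one-point interval, so injectivity holds
        only on the nondegenerate ones.\<close>
      define J where "J = {i\<in>I. u i < v i}"
      define D where "D = (\<lambda>i. {u i..v i}) ` J"
      have inj: "inj_on (\<lambda>i. {u i..v i}) J"
      proof (rule inj_onI)
        fix i j assume ij: "i \<in> J" "j \<in> J" "{u i..v i} = {u j..v j}"
        then have "u i = u j" "v i = v j" by (auto simp: J_def Icc_eq_Icc)
        with ij dj[of i j] show "i = j" by (auto simp: J_def)
      qed
      have "D division_of \<Union>D"
      proof (rule division_ofI)
        show "finite D" using fin by (simp add: D_def J_def)
        fix K assume "K \<in> D"
        then show "K \<subseteq> \<Union>D" "K \<noteq> {}" "\<exists>a b. K = cbox a b"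
          by (auto simp: D_def J_def)
        fix K' assume "K' \<in> D" "K \<noteq> K'"
        with \<open>K \<in> D\<close> obtain i j where ij: "i \<in> J" "j \<in> J" "i \<noteq> j" "K = {u i..v i}" "K' = {u j..v j}"
          by (auto simp: D_def)
        then have "v i \<le> u j \<or> v j \<le> u i" using dj[of i j] by (auto simp: J_def)
        then show "interior K \<inter> interior K' = {}"
          unfolding ij by auto
      qed simp
      moreover have "\<Union>D \<subseteq> {a..b}" using uv by (fastforce simp: D_def J_def)
      moreover have "(\<Sum>K\<in>D. Sup K - Inf K) = (\<Sum>i\<in>J. v i - u i)"
        unfolding D_def by (subst sum.reindex[OF inj]) (auto intro!: sum.cong simp: J_def)
      moreover have "(\<Sum>i\<in>J. v i - u i) = (\<Sum>i\<in>I. v i - u i)"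
        using fin uv by (intro sum.mono_neutral_left) (auto simp: J_def intro: antisym)
      moreover have "(\<Sum>K\<in>D. dist (\<gamma> (Inf K)) (\<gamma> (Sup K))) = (\<Sum>i\<in>J. dist (\<gamma> (u i)) (\<gamma> (v i)))"
        unfolding D_def by (subst sum.reindex[OF inj]) (auto intro!: sum.cong simp: J_def)
      moreover have "(\<Sum>i\<in>J. dist (\<gamma> (u i)) (\<gamma> (v i))) = (\<Sum>i\<in>I. dist (\<gamma> (u i)) (\<gamma> (v i)))"
      proof (intro sum.mono_neutral_left ballI)
        fix i assume "i \<in> I - J"
        then have "u i = v i" using uv[of i] by (auto simp: J_def)
        then show "dist (\<gamma> (u i)) (\<gamma> (v i)) = 0" by simp
      qed (use fin in \<open>auto simp: J_def\<close>)
      ultimately show "(\<Sum>i\<in>I. dist (\<gamma> (u i)) (\<gamma> (v i))) < \<epsilon>"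
        using \<delta>[of D] less by simp
    qed
    with \<open>\<delta> > 0\<close> show "\<exists>\<delta>>0. ac_modulus a b \<gamma> \<epsilon> \<delta>" by blast
  qed
next
  assume R: "\<forall>\<epsilon>>0. \<exists>\<delta>>0. ac_modulus a b \<gamma> \<epsilon> \<delta>"
  show "abs_continuous_on_interval a b \<gamma>"
    unfolding abs_continuous_on_interval_def
  proof (intro allI impI)
    fix \<epsilon> :: real assume "\<epsilon> > 0"
    then obtain \<delta> where "\<delta> > 0" and \<delta>: "ac_modulus a b \<gamma> \<epsilon> \<delta>" using R by blast
    show "\<exists>\<delta>>0. \<forall>D. D division_of \<Union>D \<and> \<Union>D \<subseteq> {a..b} \<and> (\<Sum>K\<in>D. Sup K - Inf K) < \<delta>
        \<longrightarrow> (\<Sum>K\<in>D. dist (\<gamma> (Inf K)) (\<gamma> (Sup K))) < \<epsilon>"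
    proof (intro exI[of _ \<delta>] conjI allI impI \<open>\<delta> > 0\<close>)
      fix D :: "real set set"
      assume "D division_of \<Union>D \<and> \<Union>D \<subseteq> {a..b} \<and> (\<Sum>K\<in>D. Sup K - Inf K) < \<delta>"
      then have D: "D division_of \<Union>D" and sub: "\<Union>D \<subseteq> {a..b}" and less: "(\<Sum>K\<in>D. Sup K - Inf K) < \<delta>"
        by auto
      \<comment> \<open>A one-point member of a division may lie inside another member, as its
        interior is empty, and then neither of the two precedes the other.\<close>
      define I where "I = {K\<in>D. Inf K < Sup K}"
      have K: "K = {Inf K..Sup K} \<and> Inf K \<le> Sup K" if KD: "K \<in> D" for K
      proof -
        have "K \<noteq> {}" "\<exists>a b. K = cbox a b" using division_ofD[OF D] KD by blast+
        then obtain c d where "K = {c..d}" "c \<le> d" by auto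
        then show ?thesis by simp
      qed
      have le: "Inf K \<le> Sup K" if "K \<in> D" for K using K[OF that] by (rule conjunct2)
      have fin: "finite I" using D by (auto simp: I_def)
      have uv: "a \<le> Inf K \<and> Inf K \<le> Sup K \<and> Sup K \<le> b" if "K \<in> I" for K
      proof -
        from that have KD: "K \<in> D" by (simp add: I_def)
        then have "K \<subseteq> {a..b}" using sub by blast
        with K[OF KD] show ?thesis
          by (metis atLeastatMost_subset_iff)
      qed
      have dj: "Sup K \<le> Inf L \<or> Sup L \<le> Inf K" if KL: "K \<in> I" "L \<in> I" "K \<noteq> L" for K L
      proof -
        from KL have "interior K \<inter> interior L = {}" using division_ofD(5)[OF D] by (auto simp: I_def)
        moreover have "interior K = {Inf K<..<Sup K}" "interior L = {Inf L<..<Sup L}"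
          using K[of K] K[of L] KL(1,2) interior_atLeastAtMost_real[of "Inf K" "Sup K"]
            interior_atLeastAtMost_real[of "Inf L" "Sup L"] by (auto simp only: I_def mem_Collect_eq)
        ultimately have e: "{Inf K<..<Sup K} \<inter> {Inf L<..<Sup L} = {}" by simp
        show ?thesis
        proof (rule ccontr)
          assume "\<not> ?thesis"
          with KL have "max (Inf K) (Inf L) < min (Sup K) (Sup L)" by (auto simp: I_def)
          then obtain x where "max (Inf K) (Inf L) < x" "x < min (Sup K) (Sup L)" using dense by blast
          with e show False by auto
        qed
      qed
      have "(\<Sum>K\<in>I. Sup K - Inf K) = (\<Sum>K\<in>D. Sup K - Inf K)"
        using D le by (intro sum.mono_neutral_left) (auto simp: I_def intro: antisym)
      moreover have "(\<Sum>K\<in>I. dist (\<gamma> (Inf K)) (\<gamma> (Sup K))) = (\<Sum>K\<in>D. dist (\<gamma> (Inf K)) (\<gamma> (Sup K)))"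
      proof (intro sum.mono_neutral_left ballI)
        fix K assume "K \<in> D - I"
        then have "Inf K = Sup K" using le[of K] by (auto simp: I_def)
        then show "dist (\<gamma> (Inf K)) (\<gamma> (Sup K)) = 0" by simp
      qed (use D in \<open>auto simp: I_def\<close>)
      ultimately show "(\<Sum>K\<in>D. dist (\<gamma> (Inf K)) (\<gamma> (Sup K))) < \<epsilon>"
        using ac_modulusD[OF \<delta> fin, of Inf Sup] uv dj less by simp
    qed
  qed
qed

text \<open>A monotone \<open>T\<close> keeps intervals nonoverlapping, perhaps collapsing some to
  points, and does not increase their total length, so the same \<open>\<delta>\<close> works. The
  instances are translations and the clampings \<open>min s b\<close> and
  \<open>max s b\<close>.\<close>

lemma ac_compose_mono:
  assumes "abs_continuous_on_interval a b \<gamma>" "mono T" "\<And>s t. s \<le> t \<Longrightarrow> T t - T s \<le> t - s"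
    "\<And>s. c \<le> s \<Longrightarrow> s \<le> d \<Longrightarrow> a \<le> T s \<and> T s \<le> b"
  shows "abs_continuous_on_interval c d (\<lambda>s. \<gamma> (T s))"
  unfolding ac_iff_modulus
proof (intro allI impI)
  fix \<epsilon> :: real assume "\<epsilon> > 0"
  then obtain \<delta> where "\<delta> > 0" and \<delta>: "ac_modulus a b \<gamma> \<epsilon> \<delta>"
    using assms(1) unfolding ac_iff_modulus by blast
  have "ac_modulus c d (\<lambda>s. \<gamma> (T s)) \<epsilon> \<delta>"
  proof (rule ac_modulusI)
    fix I :: "real set set" and u v
    assume I: "finite I" "\<And>i. i \<in> I \<Longrightarrow> c \<le> u i \<and> u i \<le> v i \<and> v i \<le> d"
      "\<And>i j. \<lbrakk>i \<in> I; j \<in> I; i \<noteq> j\<rbrakk> \<Longrightarrow> v i \<le> u j \<or> v j \<le> u i" "(\<Sum>i\<in>I. v i - u i) < \<delta>"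
    show "(\<Sum>i\<in>I. dist (\<gamma> (T (u i))) (\<gamma> (T (v i)))) < \<epsilon>"
    proof (rule ac_modulusD[OF \<delta> I(1), of "\<lambda>i. T (u i)" "\<lambda>i. T (v i)"])
      show "a \<le> T (u i) \<and> T (u i) \<le> T (v i) \<and> T (v i) \<le> b" if "i \<in> I" for i
        using I(2)[OF that] assms(4)[of "u i"] assms(4)[of "v i"] monoD[OF assms(2), of "u i" "v i"] by simp
      show "T (v i) \<le> T (u j) \<or> T (v j) \<le> T (u i)" if "i \<in> I" "j \<in> I" "i \<noteq> j" for i j
        using I(3)[OF that] monoD[OF assms(2)] by blast
      have "(\<Sum>i\<in>I. T (v i) - T (u i)) \<le> (\<Sum>i\<in>I. v i - u i)"
        by (rule sum_mono) (use I(2) assms(3) in simp)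
      with I(4) show "(\<Sum>i\<in>I. T (v i) - T (u i)) < \<delta>" by simp
    qed
  qed
  with \<open>\<delta> > 0\<close> show "\<exists>\<delta>>0. ac_modulus c d (\<lambda>s. \<gamma> (T s)) \<epsilon> \<delta>" by blast
qed

text \<open>Comparison principle. Two controlling curves are allowed because an increment across a
  junction involves both pieces of a joined curve.\<close>

lemma ac_bound:
  fixes \<gamma> :: "real \<Rightarrow> 'a::metric_space" and \<gamma>1 :: "real \<Rightarrow> 'b::metric_space" and \<gamma>2 :: "real \<Rightarrow> 'c::metric_space"
  assumes "abs_continuous_on_interval a b \<gamma>1" "abs_continuous_on_interval a b \<gamma>2" "L \<ge> 0"
    and le: "\<And>s t. a \<le> s \<Longrightarrow> s \<le> t \<Longrightarrow> t \<le> b \<Longrightarrow>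
      dist (\<gamma> s) (\<gamma> t) \<le> L * (dist (\<gamma>1 s) (\<gamma>1 t) + dist (\<gamma>2 s) (\<gamma>2 t))"
  shows "abs_continuous_on_interval a b \<gamma>"
  unfolding ac_iff_modulus
proof (intro allI impI)
  fix \<epsilon> :: real assume "\<epsilon> > 0"
  \<comment> \<open>Two sums below \<open>e\<close> give at most \<open>L * (2 * e)\<close>;
    \<open>L + 1\<close> in place of \<open>L\<close> keeps \<open>e\<close> positive when
    \<open>L = 0\<close>.\<close>
  define e where "e = \<epsilon> / (2 * (L + 1))"
  have e: "e > 0" using \<open>\<epsilon> > 0\<close> \<open>L \<ge> 0\<close> by (simp add: e_def)
  obtain \<delta>1 where "\<delta>1 > 0" and \<delta>1: "ac_modulus a b \<gamma>1 e \<delta>1"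
    using assms(1) e unfolding ac_iff_modulus by blast
  obtain \<delta>2 where "\<delta>2 > 0" and \<delta>2: "ac_modulus a b \<gamma>2 e \<delta>2"
    using assms(2) e unfolding ac_iff_modulus by blast
  have "ac_modulus a b \<gamma> \<epsilon> (min \<delta>1 \<delta>2)"
  proof (rule ac_modulusI)
    fix I :: "real set set" and u v
    assume I: "finite I" "\<And>i. i \<in> I \<Longrightarrow> a \<le> u i \<and> u i \<le> v i \<and> v i \<le> b"
      "\<And>i j. \<lbrakk>i \<in> I; j \<in> I; i \<noteq> j\<rbrakk> \<Longrightarrow> v i \<le> u j \<or> v j \<le> u i" "(\<Sum>i\<in>I. v i - u i) < min \<delta>1 \<delta>2"
    have "(\<Sum>i\<in>I. dist (\<gamma>1 (u i)) (\<gamma>1 (v i))) < e" using ac_modulusD[OF \<delta>1 I(1-3)] I(4) by simp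
    moreover have "(\<Sum>i\<in>I. dist (\<gamma>2 (u i)) (\<gamma>2 (v i))) < e" using ac_modulusD[OF \<delta>2 I(1-3)] I(4) by simp
    ultimately have 2: "(\<Sum>i\<in>I. dist (\<gamma>1 (u i)) (\<gamma>1 (v i)) + dist (\<gamma>2 (u i)) (\<gamma>2 (v i))) < 2 * e" (is "?S < _")
      by (simp add: sum.distrib)
    have "(\<Sum>i\<in>I. dist (\<gamma> (u i)) (\<gamma> (v i))) \<le> L * ?S"
      unfolding sum_distrib_left by (rule sum_mono) (use I(2) le in simp)
    also have "\<dots> \<le> L * (2 * e)" using 2 \<open>L \<ge> 0\<close> by (simp add: mult_left_mono)
    also have "\<dots> < (L + 1) * (2 * e)" using e by simp
    also have "\<dots> = \<epsilon>" using \<open>L \<ge> 0\<close> by (simp add: e_def field_simps)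
    finally show "(\<Sum>i\<in>I. dist (\<gamma> (u i)) (\<gamma> (v i))) < \<epsilon>" .
  qed
  then show "\<exists>\<delta>>0. ac_modulus a b \<gamma> \<epsilon> \<delta>"
    using \<open>\<delta>1 > 0\<close> \<open>\<delta>2 > 0\<close> by (intro exI[of _ "min \<delta>1 \<delta>2"]) simp
qed

lemma ac_id: "abs_continuous_on_interval a b (\<lambda>s::real. s)"
  unfolding ac_iff_modulus
proof (intro allI impI)
  fix \<epsilon> :: real assume "\<epsilon> > 0"
  have "ac_modulus a b (\<lambda>s. s) \<epsilon> \<epsilon>"
  proof (rule ac_modulusI)
    fix I :: "real set set" and u v :: "real set \<Rightarrow> real"
    assume uv: "\<And>i. i \<in> I \<Longrightarrow> a \<le> u i \<and> u i \<le> v i \<and> v i \<le> b" and less: "(\<Sum>i\<in>I. v i - u i) < \<epsilon>"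
    have "(\<Sum>i\<in>I. dist (u i) (v i)) = (\<Sum>i\<in>I. v i - u i)"
      using uv by (intro sum.cong) (auto simp: dist_real_def)
    with less show "(\<Sum>i\<in>I. dist (u i) (v i)) < \<epsilon>" by simp
  qed
  with \<open>\<epsilon> > 0\<close> show "\<exists>\<delta>>0. ac_modulus a b (\<lambda>s. s) \<epsilon> \<delta>" by blast
qed

lemma ac_lipschitz:
  assumes "abs_continuous_on_interval a b \<gamma>" "L \<ge> 0" "\<And>x y. dist (f x) (f y) \<le> L * dist x y"
  shows "abs_continuous_on_interval a b (\<lambda>s. f (\<gamma> s))"
proof (rule ac_bound[OF assms(1) assms(1) assms(2)])
  fix s t
  have "L * dist (\<gamma> s) (\<gamma> t) \<ge> 0" using \<open>L \<ge> 0\<close> by simp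
  then show "dist (f (\<gamma> s)) (f (\<gamma> t)) \<le> L * (dist (\<gamma> s) (\<gamma> t) + dist (\<gamma> s) (\<gamma> t))"
    using assms(3)[of "\<gamma> s" "\<gamma> t"] by (simp add: algebra_simps)
qed

text \<open>The increments of the clamped pieces \<open>\<gamma>1 (min s b)\<close> and
  \<open>\<gamma>2 (max s b)\<close> control those of the joined curve: across \<open>b\<close> this
  is the triangle inequality through the common value.\<close>

lemma ac_join:
  assumes "abs_continuous_on_interval a b \<gamma>1" "abs_continuous_on_interval b c \<gamma>2" "\<gamma>1 b = \<gamma>2 b" "a \<le> b" "b \<le> c"
  shows "abs_continuous_on_interval a c (\<lambda>s. if s \<le> b then \<gamma>1 s else \<gamma>2 s)"
proof (rule ac_bound[where L = 1])
  show "abs_continuous_on_interval a c (\<lambda>s. \<gamma>1 (min s b))"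
    using assms by (intro ac_compose_mono[OF assms(1)]) (auto simp: mono_def min_def)
  show "abs_continuous_on_interval a c (\<lambda>s. \<gamma>2 (max s b))"
    using assms by (intro ac_compose_mono[OF assms(2)]) (auto simp: mono_def max_def)
  fix s t assume "a \<le> s" "s \<le> t" "t \<le> c"
  then show "dist (if s \<le> b then \<gamma>1 s else \<gamma>2 s) (if t \<le> b then \<gamma>1 t else \<gamma>2 t)
    \<le> 1 * (dist (\<gamma>1 (min s b)) (\<gamma>1 (min t b)) + dist (\<gamma>2 (max s b)) (\<gamma>2 (max t b)))"
    using dist_triangle[of "\<gamma>1 s" "\<gamma>2 t" "\<gamma>1 b"] assms(3) by (auto simp: min_def max_def)
qed simp

text \<open>
  The speed of an absolutely continuous curve is not known to be measurable here, so the rules for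
  integrals are needed for arbitrary integrands.
\<close>
lemma nn_integral_le_measurable:
  assumes "\<And>g. g \<in> borel_measurable M \<Longrightarrow> (\<And>x. g x \<le> f x) \<Longrightarrow> (\<integral>\<^sup>+x. g x \<partial>M) \<le> c"
  shows "(\<integral>\<^sup>+x. f x \<partial>M) \<le> c"
  unfolding nn_integral_def
proof (intro SUP_least)
  fix g assume "g \<in> {g. simple_function M g \<and> g \<le> f}"
  then have g: "simple_function M g" "\<And>x. g x \<le> f x" by (auto simp: le_fun_def)
  show "integral\<^sup>S M g \<le> c"
    using assms[of g] g by (simp add: nn_integral_eq_simple_integral borel_measurable_simple_function)
qed

text \<open>A measurable minorant of one side is translated into one of the other; the shift by
  \<open>-h\<close> gives the reverse inequality.\<close>

lemma nn_integral_lborel_translate: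
  fixes f :: "real \<Rightarrow> ennreal"
  shows "(\<integral>\<^sup>+s. f (s + h) \<partial>lborel) = (\<integral>\<^sup>+s. f s \<partial>lborel)"
proof -
  have le: "(\<integral>\<^sup>+s. f (s + h) \<partial>lborel) \<le> (\<integral>\<^sup>+s. f s \<partial>lborel)" for f :: "real \<Rightarrow> ennreal" and h
  proof (rule nn_integral_le_measurable)
    fix g assume g: "g \<in> borel_measurable lborel" "\<And>s. g s \<le> f (s + h)"
    have "(\<integral>\<^sup>+s. g s \<partial>lborel) = (\<integral>\<^sup>+s. g (s - h) \<partial>lborel)"
      using nn_integral_real_affine[of g 1 "-h"] g(1) by simp
    also have "\<dots> \<le> (\<integral>\<^sup>+s. f s \<partial>lborel)"
      using g(2)[of "_ - h"] by (intro nn_integral_mono) simp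
    finally show "(\<integral>\<^sup>+s. g s \<partial>lborel) \<le> (\<integral>\<^sup>+s. f s \<partial>lborel)" .
  qed
  from le[of f h] le[of "\<lambda>s. f (s + h)" "-h"] show ?thesis by simp
qed

lemma nn_integral_cmult_le:
  assumes "0 < k"
  shows "(\<integral>\<^sup>+x. ennreal k * f x \<partial>M) \<le> ennreal k * (\<integral>\<^sup>+x. f x \<partial>M)"
proof (rule nn_integral_le_measurable)
  fix g assume [measurable]: "g \<in> borel_measurable M" and g: "\<And>x. g x \<le> ennreal k * f x"
  have cancel: "ennreal k * (ennreal (1 / k) * y) = y" "ennreal (1 / k) * (ennreal k * y) = y" for y
    using assms by (simp_all add: mult.assoc[symmetric] flip: ennreal_mult)
  have "(\<integral>\<^sup>+x. g x \<partial>M) = ennreal k * (\<integral>\<^sup>+x. ennreal (1 / k) * g x \<partial>M)"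
    by (simp add: nn_integral_cmult cancel)
  also have "\<dots> \<le> ennreal k * (\<integral>\<^sup>+x. f x \<partial>M)"
  proof (intro mult_left_mono nn_integral_mono)
    fix x show "ennreal (1 / k) * g x \<le> f x"
      using mult_left_mono[OF g, of "ennreal (1 / k)"] by (simp add: cancel)
  qed simp
  finally show "(\<integral>\<^sup>+x. g x \<partial>M) \<le> ennreal k * (\<integral>\<^sup>+x. f x \<partial>M)" .
qed

text \<open>Lower integrals of nonmeasurable functions are not subadditive in general. Cutting a
  measurable minorant along the measurable set \<open>A\<close>, however, leaves two measurable
  minorants.\<close>

lemma nn_integral_split_le:
  assumes [measurable]: "A \<in> sets M"
  shows "(\<integral>\<^sup>+x. f x \<partial>M) \<le> (\<integral>\<^sup>+x. f x * indicator A x \<partial>M) + (\<integral>\<^sup>+x. f x * indicator (- A) x \<partial>M)"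
proof (rule nn_integral_le_measurable)
  fix g assume [measurable]: "g \<in> borel_measurable M" and g: "\<And>x. g x \<le> f x"
  have [measurable]: "(\<lambda>x. indicator (- A) x :: ennreal) \<in> borel_measurable M"
    by (rule measurable_cong[THEN iffD1, of _ "indicator (space M - A)"]) (auto simp: indicator_def)
  have "(\<integral>\<^sup>+x. g x \<partial>M) = (\<integral>\<^sup>+x. g x * indicator A x + g x * indicator (- A) x \<partial>M)"
    by (intro nn_integral_cong) (auto simp: indicator_def)
  also have "\<dots> = (\<integral>\<^sup>+x. g x * indicator A x \<partial>M) + (\<integral>\<^sup>+x. g x * indicator (- A) x \<partial>M)"
    by (intro nn_integral_add) measurable
  also have "\<dots> \<le> (\<integral>\<^sup>+x. f x * indicator A x \<partial>M) + (\<integral>\<^sup>+x. f x * indicator (- A) x \<partial>M)"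
    using g by (intro add_mono nn_integral_mono mult_right_mono) auto
  finally show "(\<integral>\<^sup>+x. g x \<partial>M)
    \<le> (\<integral>\<^sup>+x. f x * indicator A x \<partial>M) + (\<integral>\<^sup>+x. f x * indicator (- A) x \<partial>M)" .
qed

lemma AE_lborel_translate:
  assumes "AE s in lborel. P s"
  shows "AE s::real in lborel. P (s + h)"
proof -
  obtain N where N: "{s. \<not> P s} \<subseteq> N" "N \<in> null_sets lborel" using assms by (auto simp: eventually_ae_filter)
  \<comment> \<open>Translation invariance of null sets is used for the completed measure;
    almost-everywhere statements for \<open>lebesgue\<close> and \<open>lborel\<close>
    coincide.\<close>
  have "(\<lambda>x. -h + x) ` N \<in> null_sets lebesgue"
    using N(2) by (metis negligible_iff_null_sets negligible_translation null_sets_completionI)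
  moreover have "{s. \<not> P (s + h)} \<subseteq> (\<lambda>x. -h + x) ` N"
  proof
    fix s assume "s \<in> {s. \<not> P (s + h)}"
    then have "s + h \<in> N" using N by auto
    then show "s \<in> (\<lambda>x. -h + x) ` N" by (auto intro!: image_eqI[of _ _ "s + h"])
  qed
  ultimately have "AE s in lebesgue. P (s + h)" by (auto simp: eventually_ae_filter)
  then show ?thesis by (simp add: AE_completion_iff)
qed

text \<open>Near-minimal elements of both sets are added. The form suits the triangle inequality,
  with \<open>A\<close> and \<open>B\<close> the lengths of curves along the two legs.\<close>

lemma Inf_add_le:
  fixes c :: ennreal
  assumes "\<And>x y. x \<in> A \<Longrightarrow> y \<in> B \<Longrightarrow> c \<le> x + y"
  shows "c \<le> Inf A + Inf B"
proof (rule ennreal_le_epsilon)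
  fix e :: real assume fin: "Inf A + Inf B < top" and "0 < e"
  have less: "w < w + ennreal (e / 2)" if "w < top" for w
    using that \<open>0 < e\<close> by (cases w) (auto simp flip: ennreal_plus simp: ennreal_less_iff)
  obtain x where x: "x \<in> A" "x < Inf A + ennreal (e / 2)"
    using less[of "Inf A"] fin by (auto simp: Inf_less_iff)
  obtain y where y: "y \<in> B" "y < Inf B + ennreal (e / 2)"
    using less[of "Inf B"] fin by (auto simp: Inf_less_iff)
  have "c \<le> x + y" using assms x y by blast
  also have "\<dots> \<le> (Inf A + ennreal (e / 2)) + (Inf B + ennreal (e / 2))"
    using x y by (intro add_mono) auto
  also have "\<dots> = Inf A + Inf B + (ennreal (e / 2) + ennreal (e / 2))" by (simp add: ac_simps)
  also have "ennreal (e / 2) + ennreal (e / 2) = ennreal e"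
    using \<open>0 < e\<close> by (simp flip: ennreal_plus)
  finally show "c \<le> Inf A + Inf B + ennreal e" .
qed

section \<open>Horizontal curves and their lengths\<close>

text \<open>The subtracted sum is now the one of the group law. It involves only products
  \<open>z * cnj w\<close>, which do not change when both factors are rotated by the same
  angle.\<close>

lemma T_coeff_eq: "T_coeff p v = snd v - 2 * (\<Sum>j\<in>UNIV. Im (fst p $ j * cnj (fst v $ j)))"
  by (simp add: T_coeff_def algebra_simps)

lemma linear_T_coeff: "linear (T_coeff p)"
  by (rule linearI) (simp_all add: T_coeff_def algebra_simps sum.distrib sum_subtractf sum_distrib_left)

text \<open>\<open>T_coeff p\<close> is the contact form. Orthogonality to \<open>T_field p\<close>
  puts the frame fields into its kernel, and the frame expansion of a vector in the kernel has no
  vertical term.\<close>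

lemma horizontal_space_eq: "horizontal_space p = {v. T_coeff p v = 0}"
proof (rule antisym)
  have "X_field j p \<in> {v. T_coeff p v = 0}" "Y_field j p \<in> {v. T_coeff p v = 0}" for j
    using frame_orthonormal(4,5)[of p j]
    by (simp_all add: riem_inner_def T_field_def T_coeff_def)
  moreover have "subspace {v. T_coeff p v = 0}"
    by (rule linear_subspace_kernel[OF linear_T_coeff])
  ultimately show "horizontal_space p \<subseteq> {v. T_coeff p v = 0}"
    unfolding horizontal_space_def by (intro span_minimal) auto
  show "{v. T_coeff p v = 0} \<subseteq> horizontal_space p"
  proof
    fix v assume "v \<in> {v. T_coeff p v = 0}"
    then have "v = (\<Sum>j\<in>UNIV. Re (fst v $ j) *\<^sub>R X_field j p + Im (fst v $ j) *\<^sub>R Y_field j p)"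
      using frame_expansion[of v p] by simp
    also have "\<dots> \<in> horizontal_space p"
      unfolding horizontal_space_def
      by (intro span_sum span_add span_scale span_base) auto
    finally show "v \<in> horizontal_space p" .
  qed
qed

text \<open>Lengths of horizontal curves thus depend only on the projection to C^n, and for a
  symmetry the norm has to be checked only on that component.\<close>

lemma riem_norm_horizontal:
  assumes "T_coeff p v = 0"
  shows "riem_norm p v = norm (fst v)"
  using assms by (simp add: riem_norm_def riem_inner_def norm_vec_def L2_set_def cmod_power2 flip: power2_eq_square)

text \<open>The endpoints form a null set, and away from them the derivative within
  \<open>{a..b}\<close> is the two-sided one, which suits chain rules and joining.\<close>

lemma AE_lebesgue_on_Icc_iff:
  fixes a b :: real
  shows "(AE s in lebesgue_on {a..b}. P s) \<longleftrightarrow> (AE s in lborel. a < s \<and> s < b \<longrightarrow> P s)"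
proof -
  have "(AE s in lebesgue_on {a..b}. P s) \<longleftrightarrow> (AE s in lborel. s \<in> {a..b} \<longrightarrow> P s)"
    by (simp add: AE_restrict_space_iff AE_completion_iff)
  also have "\<dots> \<longleftrightarrow> (AE s in lborel. a < s \<and> s < b \<longrightarrow> P s)"
  proof
    assume "AE s in lborel. s \<in> {a..b} \<longrightarrow> P s"
    then show "AE s in lborel. a < s \<and> s < b \<longrightarrow> P s" by eventually_elim auto
  next
    assume "AE s in lborel. a < s \<and> s < b \<longrightarrow> P s"
    then show "AE s in lborel. s \<in> {a..b} \<longrightarrow> P s"
      using AE_lborel_singleton[of a] AE_lborel_singleton[of b] by eventually_elim auto
  qed
  finally show ?thesis .
qed

lemma horizontal_curve_iff:
  "horizontal_curve a b \<gamma> \<longleftrightarrow> abs_continuous_on_interval a b \<gamma> \<and>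
     (AE s in lborel. a < s \<and> s < b \<longrightarrow> (\<exists>v. (\<gamma> has_vector_derivative v) (at s) \<and> T_coeff (\<gamma> s) v = 0))"
proof -
  have "\<gamma> differentiable (at s within {a..b}) \<and>
      vector_derivative \<gamma> (at s within {a..b}) \<in> horizontal_space (\<gamma> s) \<longleftrightarrow>
      (\<exists>v. (\<gamma> has_vector_derivative v) (at s) \<and> T_coeff (\<gamma> s) v = 0)" if "a < s" "s < b" for s
    unfolding at_within_Icc_at[OF that] horizontal_space_eq mem_Collect_eq
    by (metis vector_derivative_works vector_derivative_at differentiableI_vector)
  then have "(AE s in lborel. a < s \<and> s < b \<longrightarrow> \<gamma> differentiable (at s within {a..b}) \<and>
      vector_derivative \<gamma> (at s within {a..b}) \<in> horizontal_space (\<gamma> s)) \<longleftrightarrow>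
    (AE s in lborel. a < s \<and> s < b \<longrightarrow> (\<exists>v. (\<gamma> has_vector_derivative v) (at s) \<and> T_coeff (\<gamma> s) v = 0))"
    by (intro AE_cong) blast
  then show ?thesis
    unfolding horizontal_curve_def AE_lebesgue_on_Icc_iff by simp
qed

lemma riem_length_eq:
  assumes "horizontal_curve a b \<gamma>"
  shows "riem_length a b \<gamma> =
    (\<integral>\<^sup>+s. ennreal (norm (fst (vector_derivative \<gamma> (at s)))) * indicator {a<..<b} s \<partial>lborel)"
proof -
  have "riem_length a b \<gamma> = (\<integral>\<^sup>+s. ennreal (riem_norm (\<gamma> s) (vector_derivative \<gamma> (at s within {a..b})))
      * indicator {a..b} s \<partial>lborel)"
    unfolding riem_length_def by (simp add: nn_integral_restrict_space nn_integral_completion)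
  also have "\<dots> = (\<integral>\<^sup>+s. ennreal (norm (fst (vector_derivative \<gamma> (at s)))) * indicator {a<..<b} s \<partial>lborel)"
  proof (rule nn_integral_cong_AE)
    have "AE s in lborel. a < s \<and> s < b \<longrightarrow> (\<exists>v. (\<gamma> has_vector_derivative v) (at s) \<and> T_coeff (\<gamma> s) v = 0)"
      using assms by (simp add: horizontal_curve_iff)
    then show "AE s in lborel. ennreal (riem_norm (\<gamma> s) (vector_derivative \<gamma> (at s within {a..b})))
      * indicator {a..b} s = ennreal (norm (fst (vector_derivative \<gamma> (at s)))) * indicator {a<..<b} s"
      using AE_lborel_singleton[of a] AE_lborel_singleton[of b]
    proof eventually_elim
      case (elim s)
      show ?case
      proof (cases "a < s \<and> s < b")
        case True
        then obtain v where "(\<gamma> has_vector_derivative v) (at s)" "T_coeff (\<gamma> s) v = 0" using elim by blast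
        with True show ?thesis
          by (simp add: at_within_Icc_at vector_derivative_at riem_norm_horizontal)
      next
        case False
        with elim show ?thesis by (auto simp: indicator_def)
      qed
    qed
  qed
  finally show ?thesis .
qed

text \<open>Meant for \<open>\<eta>\<close> the image of \<open>\<gamma>\<close> under a symmetry
  with scaling factor \<open>k\<close>. Since \<open>step\<close> covers almost every parameter, the
  speeds differ by the factor \<open>k\<close> almost everywhere.\<close>

lemma horizontal_curve_transfer:
  assumes \<gamma>: "horizontal_curve a b \<gamma>" and ac: "abs_continuous_on_interval a b \<eta>" and "0 < k"
    and step: "\<And>s v. a < s \<Longrightarrow> s < b \<Longrightarrow> (\<gamma> has_vector_derivative v) (at s) \<Longrightarrow> T_coeff (\<gamma> s) v = 0 \<Longrightarrow>
      \<exists>w. (\<eta> has_vector_derivative w) (at s) \<and> T_coeff (\<eta> s) w = 0 \<and> norm (fst w) = k * norm (fst v)"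
  shows "horizontal_curve a b \<eta>" "riem_length a b \<eta> \<le> ennreal k * riem_length a b \<gamma>"
proof -
  have ae: "AE s in lborel. a < s \<and> s < b \<longrightarrow> (\<exists>v. (\<gamma> has_vector_derivative v) (at s) \<and> T_coeff (\<gamma> s) v = 0)"
    using \<gamma> by (simp add: horizontal_curve_iff)
  show \<eta>: "horizontal_curve a b \<eta>"
    unfolding horizontal_curve_iff
  proof (rule conjI[OF ac])
    from ae show "AE s in lborel. a < s \<and> s < b \<longrightarrow> (\<exists>v. (\<eta> has_vector_derivative v) (at s) \<and> T_coeff (\<eta> s) v = 0)"
      by eventually_elim (use step in blast)
  qed
  have "riem_length a b \<eta> = (\<integral>\<^sup>+s. ennreal k *
      (ennreal (norm (fst (vector_derivative \<gamma> (at s)))) * indicator {a<..<b} s) \<partial>lborel)"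
    unfolding riem_length_eq[OF \<eta>]
  proof (rule nn_integral_cong_AE)
    from ae show "AE s in lborel. ennreal (norm (fst (vector_derivative \<eta> (at s)))) * indicator {a<..<b} s
      = ennreal k * (ennreal (norm (fst (vector_derivative \<gamma> (at s)))) * indicator {a<..<b} s)"
    proof eventually_elim
      case (elim s)
      show ?case
      proof (cases "a < s \<and> s < b")
        case True
        then obtain v w where "(\<gamma> has_vector_derivative v) (at s)" "(\<eta> has_vector_derivative w) (at s)"
          "norm (fst w) = k * norm (fst v)"
          using elim step by blast
        with True \<open>0 < k\<close> show ?thesis by (simp add: vector_derivative_at ennreal_mult)
      qed (auto simp: indicator_def)
    qed
  qed
  also have "\<dots> \<le> ennreal k * riem_length a b \<gamma>"
    unfolding riem_length_eq[OF \<gamma>] by (rule nn_integral_cmult_le[OF \<open>0 < k\<close>])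
  finally show "riem_length a b \<eta> \<le> ennreal k * riem_length a b \<gamma>" .
qed

lemma horizontal_curve_shift:
  assumes "horizontal_curve a b \<gamma>"
  shows "horizontal_curve (a - h) (b - h) (\<lambda>s. \<gamma> (s + h))"
    "riem_length (a - h) (b - h) (\<lambda>s. \<gamma> (s + h)) = riem_length a b \<gamma>"
proof -
  have ac: "abs_continuous_on_interval (a - h) (b - h) (\<lambda>s. \<gamma> (s + h))"
    using assms unfolding horizontal_curve_iff
    by (intro ac_compose_mono[of a b \<gamma> "\<lambda>s. s + h"]) (auto simp: mono_def)
  have shift: "((\<lambda>s. f (s + h)) has_vector_derivative v) (at s)"
    if "(f has_vector_derivative v) (at (s + h))" for f :: "real \<Rightarrow> 'a heis" and s h v
  proof -
    have "((\<lambda>s. s + h) has_vector_derivative 1) (at s)" by (auto intro!: derivative_eq_intros)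
    from vector_diff_chain_at[OF this that] show ?thesis by (simp add: o_def)
  qed
  \<comment> \<open>An equivalence, not only the chain rule: \<open>vector_derivative\<close> is a
    choice among the derivatives, so equivalent predicates give equal values even where no
    derivative exists.\<close>
  have vd: "((\<lambda>s. \<gamma> (s + h)) has_vector_derivative v) (at s) \<longleftrightarrow> (\<gamma> has_vector_derivative v) (at (s + h))" for s v
    using shift[of \<gamma> v s h] shift[of "\<lambda>s. \<gamma> (s + h)" v "s + h" "- h"] by auto
  have "AE s in lborel. a < s \<and> s < b \<longrightarrow> (\<exists>v. (\<gamma> has_vector_derivative v) (at s) \<and> T_coeff (\<gamma> s) v = 0)"
    using assms by (simp add: horizontal_curve_iff)
  from AE_lborel_translate[OF this, of h]
  have "AE s in lborel. a - h < s \<and> s < b - h \<longrightarrow>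
      (\<exists>v. ((\<lambda>s. \<gamma> (s + h)) has_vector_derivative v) (at s) \<and> T_coeff (\<gamma> (s + h)) v = 0)"
    unfolding vd by eventually_elim auto
  with ac show h: "horizontal_curve (a - h) (b - h) (\<lambda>s. \<gamma> (s + h))"
    by (simp add: horizontal_curve_iff)
  have "vector_derivative (\<lambda>s. \<gamma> (s + h)) (at s) = vector_derivative \<gamma> (at (s + h))" for s
    unfolding vector_derivative_def vd ..
  then have "riem_length (a - h) (b - h) (\<lambda>s. \<gamma> (s + h)) =
    (\<integral>\<^sup>+s. ennreal (norm (fst (vector_derivative \<gamma> (at (s + h))))) * indicator {a<..<b} (s + h) \<partial>lborel)"
    unfolding riem_length_eq[OF h] by (intro nn_integral_cong) (auto simp: indicator_def)
  also have "\<dots> = riem_length a b \<gamma>"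
    unfolding riem_length_eq[OF assms] by (rule nn_integral_lborel_translate)
  finally show "riem_length (a - h) (b - h) (\<lambda>s. \<gamma> (s + h)) = riem_length a b \<gamma>" .
qed

lemma horizontal_curve_join:
  assumes \<gamma>: "horizontal_curve a b \<gamma>" and \<eta>: "horizontal_curve b c \<eta>" and eq: "\<gamma> b = \<eta> b" and ab: "a < b" "b < c"
  defines "\<zeta> \<equiv> \<lambda>s. if s \<le> b then \<gamma> s else \<eta> s"
  shows "horizontal_curve a c \<zeta>" "riem_length a c \<zeta> \<le> riem_length a b \<gamma> + riem_length b c \<eta>"
proof -
  have ac: "abs_continuous_on_interval a c \<zeta>"
    unfolding \<zeta>_def using assms by (intro ac_join) (auto simp: horizontal_curve_iff)
  \<comment> \<open>Off the null set \<open>{b}\<close> the joined curve agrees near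
    \<open>s\<close> with one of the pieces, hence has the same derivatives.\<close>
  have vd1: "(\<zeta> has_vector_derivative v) (at s) \<longleftrightarrow> (\<gamma> has_vector_derivative v) (at s)" if "s < b" for s v
  proof -
    have "\<forall>\<^sub>F x in nhds s. \<zeta> x = \<gamma> x"
      using eventually_nhds_in_open[of "{..<b}" s] that by (auto simp: \<zeta>_def elim: eventually_mono)
    then show ?thesis by (intro has_vector_derivative_cong_ev) (auto elim: eventually_mono simp: \<zeta>_def that less_imp_le)
  qed
  have vd2: "(\<zeta> has_vector_derivative v) (at s) \<longleftrightarrow> (\<eta> has_vector_derivative v) (at s)" if "b < s" for s v
  proof -
    have "\<forall>\<^sub>F x in nhds s. \<zeta> x = \<eta> x"
      using eventually_nhds_in_open[of "{b<..}" s] that by (auto simp: \<zeta>_def elim: eventually_mono)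
    then show ?thesis using that by (intro has_vector_derivative_cong_ev) (auto elim: eventually_mono simp: \<zeta>_def)
  qed
  have "AE s in lborel. a < s \<and> s < b \<longrightarrow> (\<exists>v. (\<gamma> has_vector_derivative v) (at s) \<and> T_coeff (\<gamma> s) v = 0)"
    "AE s in lborel. b < s \<and> s < c \<longrightarrow> (\<exists>v. (\<eta> has_vector_derivative v) (at s) \<and> T_coeff (\<eta> s) v = 0)"
    using \<gamma> \<eta> by (simp_all add: horizontal_curve_iff)
  then have "AE s in lborel. a < s \<and> s < c \<longrightarrow> (\<exists>v. (\<zeta> has_vector_derivative v) (at s) \<and> T_coeff (\<zeta> s) v = 0)"
    using AE_lborel_singleton[of b]
  proof eventually_elim
    case (elim s)
    have "\<zeta> s = \<gamma> s" if "s < b" using that by (simp add: \<zeta>_def)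
    moreover have "\<zeta> s = \<eta> s" if "b < s" using that by (simp add: \<zeta>_def)
    ultimately show ?case using elim vd1[of s] vd2[of s] by (cases "s < b") force+
  qed
  with ac show \<zeta>: "horizontal_curve a c \<zeta>" by (simp add: horizontal_curve_iff)
  have 1: "vector_derivative \<zeta> (at s) = vector_derivative \<gamma> (at s)" if "s < b" for s
    unfolding vector_derivative_def vd1[OF that] ..
  have 2: "vector_derivative \<zeta> (at s) = vector_derivative \<eta> (at s)" if "b < s" for s
    unfolding vector_derivative_def vd2[OF that] ..
  let ?f = "\<lambda>s. ennreal (norm (fst (vector_derivative \<zeta> (at s)))) * indicator {a<..<c} s"
  have "riem_length a c \<zeta> \<le> (\<integral>\<^sup>+s. ?f s * indicator {..<b} s \<partial>lborel) + (\<integral>\<^sup>+s. ?f s * indicator (- {..<b}) s \<partial>lborel)"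
    unfolding riem_length_eq[OF \<zeta>] by (rule nn_integral_split_le) simp
  also have "(\<integral>\<^sup>+s. ?f s * indicator {..<b} s \<partial>lborel) = riem_length a b \<gamma>"
    unfolding riem_length_eq[OF \<gamma>] using ab by (intro nn_integral_cong) (auto simp: indicator_def 1)
  also have "(\<integral>\<^sup>+s. ?f s * indicator (- {..<b}) s \<partial>lborel) = riem_length b c \<eta>"
    unfolding riem_length_eq[OF \<eta>]
  proof (rule nn_integral_cong_AE)
    show "AE s in lborel. ?f s * indicator (- {..<b}) s
      = ennreal (norm (fst (vector_derivative \<eta> (at s)))) * indicator {b<..<c} s"
      using AE_lborel_singleton[of b]
    proof eventually_elim
      case (elim s)
      then show ?case using ab by (auto simp: indicator_def 2)
    qed
  qed
  finally show "riem_length a c \<zeta> \<le> riem_length a b \<gamma> + riem_length b c \<eta>" .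
qed

section \<open>Triangle inequality, affine maps and segments\<close>

lemma cc_dist_le_riem_length:
  "a < b \<Longrightarrow> horizontal_curve a b \<gamma> \<Longrightarrow> cc_dist (\<gamma> a) (\<gamma> b) \<le> riem_length a b \<gamma>"
  unfolding cc_dist_def by (rule Inf_lower) auto

lemma cc_dist_triangle: "cc_dist p r \<le> cc_dist p q + cc_dist q r"
  unfolding cc_dist_def[of p q] cc_dist_def[of q r]
proof (rule Inf_add_le)
  fix x y
  assume "x \<in> {riem_length a b \<gamma> |a b \<gamma>. a < b \<and> horizontal_curve a b \<gamma> \<and> \<gamma> a = p \<and> \<gamma> b = q}"
    and "y \<in> {riem_length a b \<gamma> |a b \<gamma>. a < b \<and> horizontal_curve a b \<gamma> \<and> \<gamma> a = q \<and> \<gamma> b = r}"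
  then obtain a b \<gamma> c d \<eta> where x: "x = riem_length a b \<gamma>" "a < b" "horizontal_curve a b \<gamma>" "\<gamma> a = p" "\<gamma> b = q"
    and y: "y = riem_length c d \<eta>" "c < d" "horizontal_curve c d \<eta>" "\<eta> c = q" "\<eta> d = r"
    by blast
  \<comment> \<open>The parameter interval of the second curve is moved so that it starts where the
    first one ends; its right end becomes \<open>b + d - c\<close>.\<close>
  define \<eta>' where "\<eta>' = (\<lambda>s. \<eta> (s + (c - b)))"
  have h: "horizontal_curve b (b + d - c) \<eta>'" "riem_length b (b + d - c) \<eta>' = y"
    using horizontal_curve_shift[OF y(3), of "c - b"] y(1) by (simp_all add: \<eta>'_def algebra_simps)
  have "\<eta>' b = q" "\<eta>' (b + d - c) = r" using y by (simp_all add: \<eta>'_def)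
  then show "cc_dist p r \<le> x + y"
    using horizontal_curve_join[OF x(3) h(1)] cc_dist_le_riem_length[of a "b + d - c" "\<lambda>s. if s \<le> b then \<gamma> s else \<eta>' s"]
      x y h(2) by (auto intro: order_trans split: if_splits)
qed

text \<open>Symmetries map competing curves to competing curves. Left translations, rotations and
  conjugation enter with \<open>k = 1\<close>, dilations with their own factor.\<close>

lemma cc_dist_affine_le:
  assumes "linear L" "0 < k"
    and T: "\<And>p v. T_coeff p v = 0 \<Longrightarrow> T_coeff (L p + c) (L v) = 0"
    and N: "\<And>v. norm (fst (L v)) = k * norm (fst v)"
  shows "cc_dist (L p + c) (L q + c) \<le> ennreal k * cc_dist p q"
proof -
  interpret L: bounded_linear L using assms(1) by (simp add: linear_conv_bounded_linear)
  let ?A = "{riem_length a b \<gamma> |a b \<gamma>. a < b \<and> horizontal_curve a b \<gamma> \<and> \<gamma> a = p \<and> \<gamma> b = q}"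
  have le: "cc_dist (L p + c) (L q + c) \<le> ennreal k * x" if "x \<in> ?A" for x
  proof -
    from that obtain a b \<gamma> where x: "x = riem_length a b \<gamma>" "a < b" "horizontal_curve a b \<gamma>" "\<gamma> a = p" "\<gamma> b = q"
      by blast
    obtain K where K: "K \<ge> 0" "\<And>x. norm (L x) \<le> norm x * K" using L.nonneg_bounded by blast
    have ac: "abs_continuous_on_interval a b (\<lambda>s. L (\<gamma> s) + c)"
    proof (rule ac_lipschitz[of a b \<gamma> K])
      show "abs_continuous_on_interval a b \<gamma>" using x by (simp add: horizontal_curve_iff)
      show "dist (L x + c) (L y + c) \<le> K * dist x y" for x y
        using K(2)[of "x - y"] by (simp add: dist_norm L.diff mult.commute)
    qed (rule K)
    have step: "\<exists>w. ((\<lambda>s. L (\<gamma> s) + c) has_vector_derivative w) (at s) \<and> T_coeff (L (\<gamma> s) + c) w = 0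
        \<and> norm (fst w) = k * norm (fst v)"
      if "(\<gamma> has_vector_derivative v) (at s)" "T_coeff (\<gamma> s) v = 0" for s v
    proof (intro exI conjI)
      show "((\<lambda>s. L (\<gamma> s) + c) has_vector_derivative L v) (at s)"
        using L.has_vector_derivative[OF that(1)] by (auto intro!: derivative_eq_intros)
    qed (use T N that in auto)
    note h = horizontal_curve_transfer[OF x(3) ac assms(2) step]
    have "cc_dist (L p + c) (L q + c) \<le> riem_length a b (\<lambda>s. L (\<gamma> s) + c)"
      using cc_dist_le_riem_length[OF x(2) h(1)] x by simp
    also have "\<dots> \<le> ennreal k * x" using h(2) x by simp
    finally show ?thesis .
  qed
  have cancel: "ennreal k * (ennreal (1 / k) * y) = y" "ennreal (1 / k) * (ennreal k * y) = y" for y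
    using assms by (simp_all add: mult.assoc[symmetric] flip: ennreal_mult)
  \<comment> \<open>The factor is moved to the left so that the bare infimum stands on the
    right.\<close>
  have "ennreal (1 / k) * cc_dist (L p + c) (L q + c) \<le> cc_dist p q"
    unfolding cc_dist_def[of p q]
  proof (rule Inf_greatest)
    fix x assume "x \<in> ?A"
    from mult_left_mono[OF le[OF this], of "ennreal (1 / k)"]
    show "ennreal (1 / k) * cc_dist (L p + c) (L q + c) \<le> x" by (simp add: cancel)
  qed
  from mult_left_mono[OF this, of "ennreal k"] show ?thesis by (simp add: cancel)
qed

text \<open>The straight segment from the origin is horizontal, because the alternating form in
  \<open>T_coeff\<close> vanishes on proportional vectors.\<close>

lemma cc_dist_segment: "cc_dist 0 (z, 0) \<le> ennreal (norm z)"
proof -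
  define \<gamma> :: "real \<Rightarrow> 'a heis" where "\<gamma> = (\<lambda>s. s *\<^sub>R (z, 0))"
  have "abs_continuous_on_interval 0 1 \<gamma>"
    unfolding \<gamma>_def
    by (rule ac_lipschitz[OF ac_id, of "norm (z, 0::real)"])
      (simp_all add: dist_norm flip: scaleR_diff_left real_norm_def)
  moreover have vd: "(\<gamma> has_vector_derivative (z, 0)) (at s)" for s
    unfolding \<gamma>_def by (auto intro!: derivative_eq_intros)
  moreover have "T_coeff (\<gamma> s) (z, 0) = 0" for s
    by (simp add: T_coeff_def \<gamma>_def)
  ultimately have h: "horizontal_curve 0 1 \<gamma>" unfolding horizontal_curve_iff by blast
  have "riem_length 0 1 \<gamma> = (\<integral>\<^sup>+s. ennreal (norm z) * indicator {0<..<1::real} s \<partial>lborel)"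
    unfolding riem_length_eq[OF h] vector_derivative_at[OF vd] by simp
  also have "\<dots> = ennreal (norm z)" by (simp add: nn_integral_cmult_indicator)
  finally have "riem_length 0 1 \<gamma> = ennreal (norm z)" .
  with cc_dist_le_riem_length[OF _ h] show ?thesis by (simp add: \<gamma>_def flip: zero_prod_def)
qed

section \<open>Symmetries and continuity of the distance\<close>

lemma heis_mult_assoc: "heis_mult (heis_mult p q) r = heis_mult p (heis_mult q r)"
  by (simp add: heis_mult_def algebra_simps sum.distrib sum_subtractf)

lemma heis_mult_zero [simp]: "heis_mult p 0 = p" "heis_mult 0 p = p"
  by (simp_all add: heis_mult_def)

text \<open>The inverse is the plain negative because z times its conjugate is real.\<close>

lemma heis_mult_uminus [simp]: "heis_mult (- p) p = 0" "heis_mult p (- p) = 0"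
  by (simp_all add: heis_mult_def prod_eq_iff mult.commute)

lemma heis_mult_uminus_cancel [simp]:
  "heis_mult (- p) (heis_mult p q) = q" "heis_mult p (heis_mult (- p) q) = q"
  by (simp_all flip: heis_mult_assoc)

lemma uminus_heis_mult: "- heis_mult p q = heis_mult (- q) (- p)"
  by (simp add: heis_mult_def prod_eq_iff algebra_simps sum_subtractf)

lemma cc_dist_heis_mult [simp]: "cc_dist (heis_mult g p) (heis_mult g q) = cc_dist p q"
proof -
  have le: "cc_dist (heis_mult g p) (heis_mult g q) \<le> cc_dist p q" for g p q :: "'a heis"
  proof -
    \<comment> \<open>The differential of the left translation by \<open>g\<close>, which is an
      affine map.\<close>
    define L where "L v = (fst v, snd v + 2 * (\<Sum>j\<in>UNIV. Im (fst g $ j * cnj (fst v $ j))))" for v :: "'a heis"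
    have eq: "heis_mult g v = L v + g" for v
      by (simp add: heis_mult_def L_def prod_eq_iff)
    have "linear L"
      by (rule linearI) (simp_all add: L_def prod_eq_iff algebra_simps sum.distrib sum_subtractf sum_distrib_left)
    then have "cc_dist (L p + g) (L q + g) \<le> ennreal 1 * cc_dist p q"
    proof (rule cc_dist_affine_le)
      show "T_coeff (L p + g) (L v) = 0" if "T_coeff p v = 0" for p v
        using that by (simp add: T_coeff_def L_def algebra_simps sum.distrib sum_subtractf sum_distrib_left)
    qed (simp_all add: L_def)
    then show ?thesis by (simp add: eq)
  qed
  show ?thesis
    using le[of g p q] le[of "- g" "heis_mult g p" "heis_mult g q"] by simp
qed

section \<open>Rotations, dilations and inversion\<close>

lemma rot_zero [simp]: "rot 0 p = p"
  by (simp add: rot_def prod_eq_iff vec_eq_iff)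

lemma rot_rot: "rot \<theta> (rot \<phi> p) = rot (\<theta> + \<phi>) p"
  by (simp add: rot_def prod_eq_iff vec_eq_iff cis_mult flip: mult.assoc)

lemma linear_rot: "linear (rot \<theta>)"
  by (rule linearI) (simp_all add: rot_def prod_eq_iff vec_eq_iff algebra_simps)

lemma T_coeff_rot: "T_coeff (rot \<theta> p) (rot \<theta> v) = T_coeff p v"
proof -
  have rot: "cis t * z * cnj (cis t * w) = z * cnj w" for t z w
  proof -
    have "cis t * z * cnj (cis t * w) = (cis t * cnj (cis t)) * (z * cnj w)" by simp
    also have "cis t * cnj (cis t) = 1" by (simp add: complex_norm_square[symmetric])
    finally show ?thesis by simp
  qed
  show ?thesis by (simp only: T_coeff_eq rot_def fst_conv snd_conv vec_lambda_beta rot)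
qed

lemma cc_dist_rot [simp]: "cc_dist (rot \<theta> p) (rot \<theta> q) = cc_dist p q"
proof -
  have le: "cc_dist (rot \<theta> p) (rot \<theta> q) \<le> cc_dist p q" for \<theta> and p q :: "'a heis"
  proof -
    have "cc_dist (rot \<theta> p + 0) (rot \<theta> q + 0) \<le> ennreal 1 * cc_dist p q"
    proof (rule cc_dist_affine_le[OF linear_rot])
      show "norm (fst (rot \<theta> v)) = 1 * norm (fst v)" for v :: "'a heis"
        by (simp add: rot_def norm_vec_def norm_mult)
    qed (simp_all add: T_coeff_rot)
    then show ?thesis by simp
  qed
  show ?thesis
    using le[of \<theta> p q] le[of "- \<theta>" "rot \<theta> p" "rot \<theta> q"] by (simp add: rot_rot)
qed

text \<open>The vertical coordinate scales quadratically, like the bilinear term of the group law;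
  this is what preserves horizontality.\<close>

definition heis_dilation :: "real \<Rightarrow> 'n::finite heis \<Rightarrow> 'n heis" where
  "heis_dilation \<rho> p = (\<rho> *\<^sub>R fst p, \<rho>\<^sup>2 * snd p)"

lemma heis_dilation_zero [simp]: "heis_dilation \<rho> 0 = 0"
  by (simp add: heis_dilation_def prod_eq_iff)

text \<open>The contraction by \<open>1 / \<rho>\<close> brings the dilated points back, so the
  upper bound for it becomes this lower bound.\<close>

lemma cc_dist_heis_dilation:
  assumes "0 < \<rho>"
  shows "ennreal \<rho> * cc_dist p q \<le> cc_dist (heis_dilation \<rho> p) (heis_dilation \<rho> q)"
proof -
  have le: "cc_dist (heis_dilation \<mu> p) (heis_dilation \<mu> q) \<le> ennreal \<mu> * cc_dist p q"
    if "0 < \<mu>" for \<mu> and p q :: "'a heis"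
  proof -
    have lin: "linear (heis_dilation \<mu> :: 'a heis \<Rightarrow> 'a heis)"
      by (rule linearI) (simp_all add: heis_dilation_def prod_eq_iff algebra_simps)
    have T: "T_coeff (heis_dilation \<mu> p) (heis_dilation \<mu> v) = \<mu>\<^sup>2 * T_coeff p v" for p v :: "'a heis"
      by (simp add: T_coeff_def heis_dilation_def power2_eq_square algebra_simps sum_distrib_left)
    have "cc_dist (heis_dilation \<mu> p + 0) (heis_dilation \<mu> q + 0) \<le> ennreal \<mu> * cc_dist p q"
    proof (rule cc_dist_affine_le[OF lin that])
      show "norm (fst (heis_dilation \<mu> v)) = \<mu> * norm (fst v)" for v :: "'a heis"
        using that by (simp add: heis_dilation_def)
    qed (simp add: T)
    then show ?thesis by simp
  qed
  have inv: "heis_dilation (1 / \<rho>) (heis_dilation \<rho> p) = p" for p :: "'a heis"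
    using assms by (simp add: heis_dilation_def prod_eq_iff power_divide)
  have "ennreal \<rho> * cc_dist p q \<le> ennreal \<rho> * (ennreal (1 / \<rho>) * cc_dist (heis_dilation \<rho> p) (heis_dilation \<rho> q))"
    using le[of "1 / \<rho>" "heis_dilation \<rho> p" "heis_dilation \<rho> q"] assms
    by (intro mult_left_mono) (simp_all add: inv)
  also have "\<dots> = cc_dist (heis_dilation \<rho> p) (heis_dilation \<rho> q)"
    using assms by (simp add: mult.assoc[symmetric] flip: ennreal_mult)
  finally show ?thesis .
qed

lemma cc_dist_left_translate: "cc_dist p q = cc_dist 0 (heis_mult (- p) q)"
  using cc_dist_heis_mult[of "- p" p q] by simp

text \<open>
  Symmetry of the distance without reversing curves: \<open>(z, t) \<mapsto> (cnj z, - t)\<close> is an isometry, and a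
  rotation depending on \<open>z\<close> turns \<open>cnj z\<close> into \<open>- z\<close>.
\<close>
lemma cc_dist_zero_uminus: "cc_dist 0 (- g) = cc_dist 0 g"
proof -
  have le: "cc_dist 0 (- g) \<le> cc_dist 0 g" for g :: "'a heis"
  proof -
    define \<kappa> where "\<kappa> p = ((\<chi> j. cnj (fst p $ j)), - snd p)" for p :: "'a heis"
    have lin: "linear \<kappa>"
      by (rule linearI) (simp_all add: \<kappa>_def prod_eq_iff vec_eq_iff)
    have T: "T_coeff (\<kappa> p) (\<kappa> v) = - T_coeff p v" for p v
      by (simp add: T_coeff_def \<kappa>_def sum_negf[symmetric] algebra_simps sum_subtractf)
    have "cc_dist (\<kappa> 0 + 0) (\<kappa> g + 0) \<le> ennreal 1 * cc_dist 0 g"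
    proof (rule cc_dist_affine_le[OF lin])
      show "norm (fst (\<kappa> v)) = 1 * norm (fst v)" for v
        by (simp add: \<kappa>_def norm_vec_def)
    qed (simp_all add: T)
    moreover have "\<kappa> 0 = 0" by (simp add: \<kappa>_def prod_eq_iff vec_eq_iff)
    ultimately have \<kappa>: "cc_dist 0 (\<kappa> g) \<le> cc_dist 0 g" by simp
    have "\<exists>t. cis t * cnj z = - z" for z
    proof (cases "z = 0")
      case False
      then have "cmod (- z / cnj z) = 1" by (simp add: norm_divide)
      then have "cis (Arg (- z / cnj z)) = - z / cnj z"
        using cis_Arg[of "- z / cnj z"] False by (simp add: sgn_div_norm)
      with False have "cis (Arg (- z / cnj z)) * cnj z = - z" by simp
      then show ?thesis ..
    qed simp
    then obtain t where t: "\<And>z. cis (t z) * cnj z = - z" by metis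
    have "rot (\<chi> j. t (fst g $ j)) (\<kappa> g) = - g"
      by (simp add: rot_def \<kappa>_def prod_eq_iff vec_eq_iff t)
    moreover have "rot (\<chi> j. t (fst g $ j)) 0 = (0 :: 'a heis)"
      by (simp add: rot_def prod_eq_iff vec_eq_iff)
    ultimately show ?thesis
      using \<kappa> cc_dist_rot[of "\<chi> j. t (fst g $ j)" 0 "\<kappa> g"] by simp
  qed
  from le[of g] le[of "- g"] show ?thesis by simp
qed

lemma cc_dist_commute: "cc_dist p q = cc_dist q p"
proof -
  have "- heis_mult (- p) q = heis_mult (- q) p" by (simp add: uminus_heis_mult)
  then show ?thesis
    using cc_dist_zero_uminus[of "heis_mult (- p) q"] by (simp add: cc_dist_left_translate[of p q] cc_dist_left_translate[of q p])
qed

section \<open>Upper bounds, finiteness and continuity\<close>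

lemma cc_dist_zero_heis_mult: "cc_dist 0 (heis_mult g h) \<le> cc_dist 0 g + cc_dist 0 h"
  using cc_dist_triangle[of 0 "heis_mult g h" g] cc_dist_heis_mult[of g 0 h] by simp

lemma cc_dist_vertical_le: "cc_dist 0 ((0, t) :: 'n::finite heis) \<le> ennreal (2 * sqrt \<bar>t\<bar>)"
proof -
  \<comment> \<open>The commutator of \<open>a\<close> and \<open>b\<close> has vertical part plus
    or minus \<open>4 * s * s\<close>, which has to be \<open>t\<close>; four segments of length
    \<open>s\<close> then add up to \<open>2 * sqrt \<bar>t\<bar>\<close>. The sign of
    \<open>t\<close> is carried by \<open>\<alpha>\<close>.\<close>
  define s where "s = sqrt \<bar>t\<bar> / 2"
  obtain j :: 'n where True by blast
  define \<alpha> where "\<alpha> = (if t \<ge> 0 then \<i> else - \<i>) * complex_of_real s"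
  define a :: "'n heis" where "a = (axis j \<alpha>, 0)"
  define b :: "'n heis" where "b = (axis j (complex_of_real s), 0)"
  have s: "s \<ge> 0" "4 * s * s = \<bar>t\<bar>" by (auto simp: s_def)
  have mult: "heis_mult (axis j c, x) (axis j d, y) = (axis j (c + d), x + y + 2 * Im (c * cnj d))" for c d x y
  proof -
    have "(\<Sum>i\<in>UNIV. Im (axis j c $ i * cnj (axis j d $ i))) = (\<Sum>i\<in>UNIV. if i = j then Im (c * cnj d) else 0)"
      by (rule sum.cong) (auto simp: axis_def)
    then show ?thesis by (auto simp: heis_mult_def axis_def vec_eq_iff)
  qed
  have \<alpha>: "norm \<alpha> = s" using s by (simp add: \<alpha>_def norm_mult)
  have norm: "norm (axis j c :: complex ^ 'n) = norm c" for c
  proof -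
    have "(\<Sum>i\<in>UNIV. (norm ((axis j c :: complex ^ 'n) $ i))\<^sup>2) = (\<Sum>i\<in>UNIV. if i = j then (norm c)\<^sup>2 else 0)"
      by (rule sum.cong) (auto simp: axis_def)
    then show ?thesis by (simp add: norm_vec_def L2_set_def)
  qed
  have neg: "- (axis j c, x) = (axis j (- c), - x)" for c :: complex and x :: real
    by (simp add: axis_def vec_eq_iff)
  \<comment> \<open>a vertical element is a commutator of horizontal ones\<close>
  have t: "(0, t) = heis_mult (heis_mult a b) (heis_mult (- a) (- b))"
    using s unfolding a_def b_def neg mult by (auto simp: \<alpha>_def axis_def vec_eq_iff)
  have pos: "cc_dist 0 a \<le> ennreal s" "cc_dist 0 b \<le> ennreal s"
    using cc_dist_segment[of "axis j \<alpha>"] cc_dist_segment[of "axis j (complex_of_real s)"] s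
    by (simp_all add: a_def b_def \<alpha> norm)
  then have neg: "cc_dist 0 (- a) \<le> ennreal s" "cc_dist 0 (- b) \<le> ennreal s"
    by (simp_all add: cc_dist_zero_uminus)
  note le = order_trans[OF cc_dist_zero_heis_mult add_mono]
  have "cc_dist 0 ((0, t) :: 'n heis) \<le> (ennreal s + ennreal s) + (ennreal s + ennreal s)"
    unfolding t by (rule le[OF le[OF pos] le[OF neg]])
  also have "\<dots> = ennreal (2 * sqrt \<bar>t\<bar>)"
    using s(1) by (simp add: s_def flip: ennreal_plus)
  finally show ?thesis .
qed

text \<open>The product of \<open>- p\<close> and \<open>q\<close> factors into a horizontal and a
  vertical element. The bound is continuous in \<open>q\<close> and zero at \<open>q = p\<close>, so
  it yields both finiteness and continuity of the distance.\<close>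

lemma cc_dist_le:
  fixes p q :: "'n::finite heis"
  shows "cc_dist p q \<le> ennreal (norm (fst q - fst p) + 2 * sqrt \<bar>snd (heis_mult (- p) q)\<bar>)"
proof -
  define z where "z = fst q - fst p"
  define t where "t = snd (heis_mult (- p) q)"
  have "heis_mult (- p) q = heis_mult (z, 0) (0, t)"
    by (simp add: heis_mult_def z_def t_def prod_eq_iff)
  then have "cc_dist p q \<le> cc_dist 0 (z, 0) + cc_dist 0 ((0, t) :: 'n heis)"
    using cc_dist_zero_heis_mult[of "(z, 0)" "(0, t)"] by (simp add: cc_dist_left_translate[of p q])
  also have "\<dots> \<le> ennreal (norm z) + ennreal (2 * sqrt \<bar>t\<bar>)"
    by (intro add_mono cc_dist_segment cc_dist_vertical_le)
  also have "\<dots> = ennreal (norm z + 2 * sqrt \<bar>t\<bar>)"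
    by (simp add: ennreal_plus)
  finally show ?thesis by (simp add: z_def t_def)
qed

lemma cc_dist_finite [simp]: "cc_dist p q < top" "cc_dist p q \<noteq> top"
  using order_le_less_trans[OF cc_dist_le ennreal_less_top, of p q] by auto

lemma continuous_heis_mult: "continuous_on S (heis_mult p)"
  unfolding heis_mult_def by (intro continuous_intros)

text \<open>Here \<open>ball\<close> is Euclidean. Measure and frontier are Euclidean notions while
  diameters refer to \<open>cc_dist\<close>; this is the link between the two.\<close>

lemma cc_dist_small:
  assumes "0 < e"
  obtains r where "0 < r" "\<And>x. x \<in> ball p r \<Longrightarrow> cc_dist p x < ennreal e"
proof -
  define f where "f x = norm (fst x - fst p) + 2 * sqrt \<bar>snd (heis_mult (- p) x)\<bar>" for x
  have "continuous_on UNIV f"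
    unfolding f_def by (intro continuous_intros continuous_heis_mult)
  moreover have "f p = 0" by (simp add: f_def)
  ultimately obtain r where r: "0 < r" "\<And>x. dist x p < r \<Longrightarrow> f x < e"
    using assms unfolding continuous_on_iff by (metis UNIV_I abs_less_iff diff_zero dist_real_def)
  have "cc_dist p x < ennreal e" if "x \<in> ball p r" for x
  proof -
    have "cc_dist p x \<le> ennreal (f x)" unfolding f_def by (rule cc_dist_le)
    also have "\<dots> < ennreal e" using r(2)[of x] that assms by (simp add: dist_commute ennreal_lessI)
    finally show ?thesis .
  qed
  with r(1) that show ?thesis by blast
qed

lemma continuous_cc_dist: "continuous_on S (\<lambda>q. enn2real (cc_dist p q))"
proof -
  let ?d = "\<lambda>p q. enn2real (cc_dist p q)"
  have tri: "?d p x \<le> ?d p y + ?d y x" for x y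
  proof -
    have "?d p x \<le> enn2real (cc_dist p y + cc_dist y x)"
      by (intro enn2real_mono cc_dist_triangle) (simp add: ennreal_add_less_top)
    then show ?thesis by (simp add: enn2real_plus)
  qed
  have "isCont (?d p) x" for x
    unfolding continuous_at_eps_delta
  proof (intro allI impI)
    fix e :: real assume "e > 0"
    then obtain r where r: "0 < r" "\<And>y. y \<in> ball x r \<Longrightarrow> cc_dist x y < ennreal e"
      using cc_dist_small by blast
    have "\<bar>?d p y - ?d p x\<bar> < e" if "dist y x < r" for y
    proof -
      have "?d x y < e" using r(2)[of y] that \<open>e > 0\<close>
        by (simp add: dist_commute enn2real_less_iff)
      then show ?thesis using tri[of x y] tri[of y x] unfolding cc_dist_commute[of y x] by linarith
    qed
    then show "\<exists>d>0. \<forall>y. dist y x < d \<longrightarrow> dist (?d p y) (?d p x) < e"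
      using r(1) by (auto simp: dist_real_def)
  qed
  then show ?thesis by (simp add: continuous_at_imp_continuous_on)
qed

section \<open>Isodiametric sets\<close>

lemma cc_diam_upper: "p \<in> F \<Longrightarrow> q \<in> F \<Longrightarrow> cc_dist p q \<le> cc_diam F"
  unfolding cc_diam_def by (rule SUP_upper2[of p]) (auto intro: SUP_upper)

lemma cc_diam_least: "(\<And>p q. p \<in> F \<Longrightarrow> q \<in> F \<Longrightarrow> cc_dist p q \<le> D) \<Longrightarrow> cc_diam F \<le> D"
  unfolding cc_diam_def by (intro SUP_least)

lemma cc_dist_attains_sup:
  assumes "compact E" "E \<noteq> {}"
  obtains q where "q \<in> E" "\<And>x. x \<in> E \<Longrightarrow> cc_dist p x \<le> cc_dist p q"
proof -
  obtain q where q: "q \<in> E" "\<And>x. x \<in> E \<Longrightarrow> enn2real (cc_dist p x) \<le> enn2real (cc_dist p q)"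
    using continuous_attains_sup[OF assms continuous_cc_dist] by blast
  have "cc_dist p x \<le> cc_dist p q" if "x \<in> E" for x
    using ennreal_leI[OF q(2)[OF that]] by (simp add: ennreal_enn2real_if)
  with q(1) that show ?thesis by blast
qed

lemma cc_diam_finite:
  fixes E :: "'n::finite heis set"
  assumes "compact E"
  shows "cc_diam E < top"
proof (cases "E = {}")
  case False
  then obtain q :: "'n heis" where q: "\<And>x. x \<in> E \<Longrightarrow> cc_dist 0 x \<le> cc_dist 0 q"
    using cc_dist_attains_sup[OF assms, of 0] by blast
  have "cc_diam E \<le> cc_dist 0 q + cc_dist 0 q"
  proof (rule cc_diam_least)
    fix x y assume xy: "x \<in> E" "y \<in> E"
    have "cc_dist x y \<le> cc_dist 0 x + cc_dist 0 y"
      using cc_dist_triangle[of x y 0] unfolding cc_dist_commute[of x 0] .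
    also have "\<dots> \<le> cc_dist 0 q + cc_dist 0 q" by (intro add_mono q xy)
    finally show "cc_dist x y \<le> cc_dist 0 q + cc_dist 0 q" .
  qed
  then show ?thesis by (rule order_le_less_trans) simp
qed (simp add: cc_diam_def bot_ennreal)

text \<open>\<open>F\<close> is an arbitrary superset, hence the outer measure. The gain is strict
  because the compact set \<open>E\<close> has finite measure.\<close>

lemma outer_measure_less_of_frontier:
  fixes E F :: "'n::finite heis set"
  assumes E: "compact E" "p \<in> frontier E" and F: "E \<union> ball p r \<subseteq> F" "0 < r"
  shows "outer_measure_of lebesgue E < outer_measure_of lebesgue F"
proof -
  define U where "U = ball p r - E"
  have "open U" unfolding U_def using E(1) by (intro open_Diff) (auto intro: compact_imp_closed)
  moreover obtain x where "x \<notin> E" "dist p x < r"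
    using E(2) F(2) unfolding frontier_straddle by blast
  then have "U \<noteq> {}" by (auto simp: U_def)
  ultimately have "\<not> negligible U" by (rule open_not_negligible)
  then have pos: "emeasure lebesgue U \<noteq> 0"
    using \<open>open U\<close> by (auto simp: negligible_iff_null_sets null_sets_def)
  have sets: "E \<in> sets lebesgue" "U \<in> sets lebesgue"
    using E(1) \<open>open U\<close> by (auto intro: lmeasurable_compact fmeasurableD)
  have "emeasure lebesgue E < emeasure lebesgue E + emeasure lebesgue U"
    using fmeasurableD2[OF lmeasurable_compact[OF E(1)]] pos
    by (simp add: ennreal_add_left_cancel_less[of "emeasure lebesgue E" 0, simplified] top.not_eq_extremum zero_less_iff_neq_zero)
  also have "\<dots> = emeasure lebesgue (E \<union> U)"
    by (rule plus_emeasure) (use sets in \<open>auto simp: U_def\<close>)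
  also have "\<dots> = outer_measure_of lebesgue (E \<union> U)" using sets by simp
  also have "\<dots> \<le> outer_measure_of lebesgue F"
    using F(1) by (intro outer_measure_of_mono) (auto simp: U_def)
  finally show ?thesis using sets by simp
qed

text \<open>\<open>G = {0}\<close> gives the unrestricted class and \<open>G = UNIV\<close> the rotationally invariant one.\<close>
lemma isodiam_frontier_far_point:
  fixes E :: "'n::finite heis set" and G :: "(real ^ 'n) set"
  assumes E: "E \<in> isodiam_sets_in \<C>" and p: "p \<in> frontier E"
    and G: "0 \<in> G" "\<And>\<theta> \<phi>. \<theta> \<in> G \<Longrightarrow> \<phi> \<in> G \<Longrightarrow> \<theta> - \<phi> \<in> G"
    and inv: "\<And>\<theta>. \<theta> \<in> G \<Longrightarrow> rot \<theta> ` E \<subseteq> E"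
    and comp: "\<And>B. E \<union> (\<Union>\<theta>\<in>G. rot \<theta> ` B) \<in> \<C>"
  shows "\<exists>q\<in>E. cc_dist p q = cc_diam E"
proof (rule ccontr)
  assume far: "\<not> ?thesis"
  have cpt: "compact E" and pos: "0 < cc_diam E"
    and ext: "outer_measure_of lebesgue E = isodiam_const \<C> * cc_diam E ^ (2 * CARD('n) + 2)"
    using E by (auto simp: isodiam_sets_in_def)
  have fin: "cc_diam E < top" by (rule cc_diam_finite[OF cpt])
  have pE: "p \<in> E" using p frontier_subset_compact[OF cpt] by blast
  obtain q where q: "q \<in> E" "\<And>x. x \<in> E \<Longrightarrow> cc_dist p x \<le> cc_dist p q"
    using cc_dist_attains_sup[OF cpt, of p] pE by blast
  define D where "D = enn2real (cc_diam E)"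
  define M where "M = enn2real (cc_dist p q)"
  have D: "cc_diam E = ennreal D" and M: "cc_dist p q = ennreal M" "M \<ge> 0"
    using fin by (auto simp: D_def M_def ennreal_enn2real_if)
  have "cc_dist p q < cc_diam E" using far q(1) cc_diam_upper[OF pE q(1)] by (auto simp: order_less_le)
  then have MD: "M < D" using D M by (simp add: ennreal_less_iff)
  \<comment> \<open>Half the gap: the centres of two copies of the ball are at distance at most
    \<open>M\<close>, and each of two points in these copies adds at most \<open>e\<close>.\<close>
  define e where "e = (D - M) / 2"
  have e: "e > 0" "M + 2 * e = D" using MD by (auto simp: e_def field_simps)
  obtain r where r: "0 < r" "\<And>x. x \<in> ball p r \<Longrightarrow> cc_dist p x < ennreal e"
    using cc_dist_small[OF e(1)] by blast
  define F where "F = E \<union> (\<Union>\<theta>\<in>G. rot \<theta> ` ball p r)"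
  have Mx: "cc_dist p x \<le> ennreal M" if "x \<in> E" for x using q(2)[OF that] M by simp
  have near: "cc_dist u x \<le> ennreal D" if u: "u \<in> ball p r" and x: "x \<in> E" for u x
  proof -
    have "cc_dist u x \<le> cc_dist p u + cc_dist p x"
      using cc_dist_triangle[of u x p] by (simp add: cc_dist_commute[of u p])
    also have "\<dots> \<le> ennreal e + ennreal M"
      using r(2)[OF u] Mx[OF x] by (intro add_mono) auto
    also have "\<dots> = ennreal (e + M)" using e M by (simp add: ennreal_plus)
    also have "\<dots> \<le> ennreal D" using e by (intro ennreal_leI) simp
    finally show ?thesis .
  qed
  \<comment> \<open>As \<open>E\<close> is invariant under \<open>G\<close>, the rotation can be
    moved from the point of the ball to the point of \<open>E\<close>.\<close>
  have EB: "cc_dist (rot \<theta> u) x \<le> ennreal D" if "\<theta> \<in> G" "u \<in> ball p r" "x \<in> E" for \<theta> u x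
  proof -
    have "0 - \<theta> \<in> G" using G that by blast
    then have "rot (- \<theta>) x \<in> E" using inv[of "- \<theta>"] that by auto
    moreover have "cc_dist (rot \<theta> u) x = cc_dist u (rot (- \<theta>) x)"
      using cc_dist_rot[of "- \<theta>" "rot \<theta> u" x] by (simp add: rot_rot)
    ultimately show ?thesis using near that by simp
  qed
  \<comment> \<open>Rotating both points by \<open>- \<theta>\<close> leaves the angle
    \<open>\<phi> - \<theta>\<close>; the triangle inequality then passes through \<open>p\<close>
    and the rotated centre, which is a point of \<open>E\<close>.\<close>
  have BB: "cc_dist (rot \<theta> u) (rot \<phi> v) \<le> ennreal D"
    if "\<theta> \<in> G" "\<phi> \<in> G" "u \<in> ball p r" "v \<in> ball p r" for \<theta> \<phi> u v
  proof -
    have rp: "rot (\<phi> - \<theta>) p \<in> E" using inv[of "\<phi> - \<theta>"] G(2) that pE by blast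
    have "cc_dist (rot \<theta> u) (rot \<phi> v) = cc_dist u (rot (\<phi> - \<theta>) v)"
      using cc_dist_rot[of "- \<theta>" "rot \<theta> u" "rot \<phi> v"] by (simp add: rot_rot)
    also have "\<dots> \<le> cc_dist p u + cc_dist p (rot (\<phi> - \<theta>) v)"
      using cc_dist_triangle[of u _ p] by (simp add: cc_dist_commute[of u p])
    also have "\<dots> \<le> cc_dist p u + (cc_dist p (rot (\<phi> - \<theta>) p) + cc_dist p v)"
      using cc_dist_triangle[of p "rot (\<phi> - \<theta>) v" "rot (\<phi> - \<theta>) p"] by (simp add: add_left_mono)
    also have "\<dots> \<le> ennreal e + (ennreal M + ennreal e)"
      by (intro add_mono Mx rp less_imp_le[OF r(2)] that)
    also have "\<dots> = ennreal D" using e M by (simp flip: ennreal_plus)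
    finally show ?thesis .
  qed
  have "cc_diam F \<le> ennreal D"
  proof (rule cc_diam_least)
    fix x y assume "x \<in> F" "y \<in> F"
    then consider "x \<in> E" "y \<in> E"
      | \<theta> u where "x \<in> E" "y = rot \<theta> u" "\<theta> \<in> G" "u \<in> ball p r"
      | \<theta> u where "x = rot \<theta> u" "\<theta> \<in> G" "u \<in> ball p r" "y \<in> E"
      | \<theta> u \<phi> v where "x = rot \<theta> u" "\<theta> \<in> G" "u \<in> ball p r" "y = rot \<phi> v" "\<phi> \<in> G" "v \<in> ball p r"
      unfolding F_def by blast
    then show "cc_dist x y \<le> ennreal D"
    proof cases
      case 1
      then show ?thesis using cc_diam_upper[of x E y] D by simp
    next
      case 2
      then show ?thesis using EB[of \<theta> u x] by (simp add: cc_dist_commute[of x])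
    next
      case 3
      then show ?thesis using EB[of \<theta> u y] by simp
    next
      case 4
      then show ?thesis using BB[of \<theta> \<phi> u v] by simp
    qed
  qed
  moreover have "cc_diam E \<le> cc_diam F"
    by (rule cc_diam_least, rule cc_diam_upper) (auto simp: F_def)
  ultimately have diam: "cc_diam F = cc_diam E" using D by simp
  let ?k = "2 * CARD('n) + 2"
  have "outer_measure_of lebesgue F / cc_diam F ^ ?k \<le> isodiam_const \<C>"
    unfolding isodiam_const_def
  proof (rule SUP_upper)
    show "F \<in> {F \<in> \<C>. 0 < cc_diam F \<and> cc_diam F < \<infinity>}"
      using comp[of "ball p r"] pos fin diam by (simp add: F_def infinity_ennreal_def)
  qed
  then have "outer_measure_of lebesgue F / cc_diam E ^ ?k * cc_diam E ^ ?k \<le> outer_measure_of lebesgue E"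
    unfolding ext diam by (rule mult_right_mono) simp
  \<comment> \<open>Clearing the denominator in \<open>ennreal\<close> is legitimate because the
    diameter is positive and finite.\<close>
  moreover have "cc_diam E ^ ?k / cc_diam E ^ ?k = 1"
    using pos fin by (intro ennreal_divide_self) (auto simp only: less_top[symmetric] power_eq_0_iff power_eq_top_ennreal)
  ultimately have "outer_measure_of lebesgue F \<le> outer_measure_of lebesgue E"
    by (simp only: ennreal_divide_times mult_1_right)
  moreover have "ball p r \<subseteq> (\<Union>\<theta>\<in>G. rot \<theta> ` ball p r)"
  proof
    fix x assume "x \<in> ball p r"
    then have "rot 0 x \<in> (\<Union>\<theta>\<in>G. rot \<theta> ` ball p r)" using G(1) by blast
    then show "x \<in> (\<Union>\<theta>\<in>G. rot \<theta> ` ball p r)" by (simp only: rot_zero)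
  qed
  then have "outer_measure_of lebesgue E < outer_measure_of lebesgue F"
    by (intro outer_measure_less_of_frontier[OF cpt p _ r(1)]) (auto simp: F_def)
  ultimately show False by simp
qed

text \<open>A maximal distance from \<open>p\<close> is not attained at an interior point, since the dilations
  centred at \<open>p\<close> move that point outwards.\<close>
lemma cc_dist_max_frontier:
  assumes "compact E" "p \<in> E" "q \<in> E" "cc_dist p q = cc_diam E" "0 < cc_diam E"
  shows "q \<in> frontier E"
proof (rule ccontr)
  assume "q \<notin> frontier E"
  with assms(3) closure_subset[of E] have int: "q \<in> interior E" by (auto simp: frontier_def)
  \<comment> \<open>The dilation centred at \<open>p\<close> is the one at the origin conjugated by
    a left translation. Since \<open>f 1 = q\<close>, factors slightly above 1 still lead into
    \<open>interior E\<close>.\<close>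
  define f where "f \<rho> = heis_mult p (heis_dilation \<rho> (heis_mult (- p) q))" for \<rho>
  have "continuous_on UNIV f"
    unfolding f_def heis_dilation_def heis_mult_def by (intro continuous_intros)
  then have "open (f -` interior E)" by (intro open_vimage) auto
  moreover have "1 \<in> f -` interior E" using int by (simp add: f_def heis_dilation_def)
  ultimately obtain d where d: "d > 0" "ball 1 d \<subseteq> f -` interior E"
    by (rule openE)
  have "1 + d / 2 \<in> ball 1 d" using d(1) by (simp add: dist_real_def)
  then have "f (1 + d / 2) \<in> E" using d(2) interior_subset[of E] by blast
  define w where "w = heis_mult (- p) q"
  have "ennreal (1 + d / 2) * cc_dist 0 w \<le> cc_dist (heis_dilation (1 + d / 2) 0) (heis_dilation (1 + d / 2) w)"
    using d(1) by (intro cc_dist_heis_dilation) simp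
  also have "\<dots> = cc_dist p (f (1 + d / 2))"
    using cc_dist_heis_mult[of p 0 "heis_dilation (1 + d / 2) w"] by (simp add: f_def w_def)
  also have "\<dots> \<le> cc_diam E" using \<open>f (1 + d / 2) \<in> E\<close> assms(2) by (intro cc_diam_upper)
  finally have "ennreal (1 + d / 2) * cc_diam E \<le> cc_diam E"
    using assms(4) by (simp add: w_def flip: cc_dist_left_translate)
  moreover obtain D where D: "cc_diam E = ennreal D" "D > 0"
    using cc_diam_finite[OF assms(1)] assms(5) by (cases "cc_diam E") auto
  ultimately have "ennreal ((1 + d / 2) * D) \<le> ennreal D"
    using d(1) by (subst ennreal_mult) auto
  then have "(1 + d / 2) * D \<le> D" using D(2) by (subst (asm) ennreal_le_iff) auto
  with mult_pos_pos[OF D(2) d(1)] show False by (simp add: algebra_simps)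
qed

theorem proposition3p2:
  fixes E :: "'n::finite heis set"
  assumes "E \<in> isodiam_sets \<union> rot_isodiam_sets"
  shows "\<forall>p \<in> frontier E. \<exists>q \<in> frontier E. cc_dist p q = cc_diam E"
proof
  fix p assume p: "p \<in> frontier E"
  have E: "compact E" "0 < cc_diam E" using assms by (auto simp: isodiam_sets_in_def)
  have pE: "p \<in> E" using p frontier_subset_compact[OF E(1)] by blast
  have "\<exists>q\<in>E. cc_dist p q = cc_diam E"
    using assms
  proof
    assume "E \<in> isodiam_sets"
    then show ?thesis by (rule isodiam_frontier_far_point[where G = "{0}"]) (use p in auto)
  next
    assume rot: "E \<in> rot_isodiam_sets"
    then have inv: "rot \<theta> ` E \<subseteq> E" for \<theta> by (simp add: isodiam_sets_in_def rot_invariant_sets_def)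
    show ?thesis
    proof (rule isodiam_frontier_far_point[OF rot p, where G = UNIV])
      fix B :: "'n heis set"
      \<comment> \<open>The orbit of any set under all rotations is invariant, so the ball whose
        copies are added need not be.\<close>
      have "rot \<theta> x \<in> E \<union> (\<Union>\<phi>. rot \<phi> ` B)" if x: "x \<in> E \<union> (\<Union>\<phi>. rot \<phi> ` B)" for \<theta> x
      proof (cases "x \<in> E")
        case True
        then show ?thesis using inv by blast
      next
        case False
        then obtain \<phi> u where "x = rot \<phi> u" "u \<in> B" using x by blast
        then have "rot \<theta> x \<in> rot (\<theta> + \<phi>) ` B" by (simp add: rot_rot)
        then show ?thesis by blast
      qed
      then show "E \<union> (\<Union>\<phi>. rot \<phi> ` B) \<in> rot_invariant_sets"
        unfolding rot_invariant_sets_def by blast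
    qed (use inv in simp_all)
  qed
  then obtain q where q: "q \<in> E" "cc_dist p q = cc_diam E" by blast
  with cc_dist_max_frontier[OF E(1) pE q E(2)]
  show "\<exists>q \<in> frontier E. cc_dist p q = cc_diam E" by blast
qed

end
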